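(* Let $d \geq 2$ and consider site percolation on $\mathbb{Z}^d$ at its critical probability $p_c = p_c(d)$. There is a constant $c>0$, which depends only on the dimension $d$, such that for all $x \in \mathbb{Z}^d$ with $x\neq 0$, $$\mathbb{P}_{p_c}\bigl(0 \leftrightarrow x \text{ in } \Lambda(4 \|x\|)\bigr) \geq \frac{c}{\|x\|^{d^2}}.$$
   Context: $\mathbb{Z}^d$ is viewed as a graph in which $v,w$ are neighbours iff $\sum_{i=1}^d |v_i-w_i|=1$. In site percolation with parameter $p\in[0,1]$ each vertex is independently open with probability $p$ and closed otherwise; $\mathbb{P}_p$ is the resulting probability measure. The critical probability is $p_c=p_c(d)=\sup\{p : \mathbb{P}_p(\text{there is an infinite connected set of open vertices})=0\}$. For $x\in\mathbb{Z}^d$, $\|x\|:=\max_{1\leq i\leq d}|x_i|$. For $n\ge 0$, $\Lambda(n):=[-n,n]^d$ (its lattice points). A path is a finite sequence of vertices $v(1),\dots,v(k)$ with $\sum_{l}|v(i+1)_l-v(i)_l|\le 1$ for all $1\le i\le k-1$; it is open if all its vertices are open. The event $\{0 \leftrightarrow x \text{ in } \Lambda(4\|x\|)\}$ is the event that there is an open path from $0$ to $x$ all of whose vertices lie in $\Lambda(4\|x\|)$. *)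

theory Defs
  imports "HOL-Probability.Probability"
begin

text \<open>
  The dimension \<open>d\<close> is \<open>CARD('d)\<close> for a finite index type \<open>'d\<close>; the lattice is \<open>int ^ 'd\<close>.
\<close>

type_synonym 'd site = "int ^ 'd"

text \<open>A configuration maps a site to \<open>True\<close> iff that site is open.\<close>

type_synonym 'd config = "'d site \<Rightarrow> bool"

definition l1_dist :: "'d::finite site \<Rightarrow> 'd site \<Rightarrow> int" where
  "l1_dist v w = (\<Sum>i\<in>UNIV. \<bar>v $ i - w $ i\<bar>)"

definition neighbours :: "'d::finite site \<Rightarrow> 'd site \<Rightarrow> bool" where
  "neighbours v w \<longleftrightarrow> l1_dist v w = 1"

definition max_norm :: "'d::finite site \<Rightarrow> int" where
  "max_norm x = Max (range (\<lambda>i. \<bar>x $ i\<bar>))"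

definition lattice_box :: "int \<Rightarrow> 'd::finite site set" where
  "lattice_box n = {v. \<forall>i. v $ i \<in> {-n..n}}"

definition connected_sites :: "'d::finite site set \<Rightarrow> bool" where
  "connected_sites C \<longleftrightarrow>
     (\<forall>v\<in>C. \<forall>w\<in>C. (\<lambda>a b. a \<in> C \<and> b \<in> C \<and> neighbours a b)\<^sup>*\<^sup>* v w)"

text \<open>Paths may pause: consecutive vertices are at distance at most 1, so they may coincide.\<close>

definition lattice_path :: "'d::finite site list \<Rightarrow> bool" where
  "lattice_path vs \<longleftrightarrow> vs \<noteq> [] \<and> successively (\<lambda>v w. l1_dist v w \<le> 1) vs"

definition open_connection_in ::
  "'d::finite config \<Rightarrow> 'd site set \<Rightarrow> 'd site \<Rightarrow> 'd site \<Rightarrow> bool" where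
  "open_connection_in \<omega> A x y \<longleftrightarrow>
     (\<exists>vs. lattice_path vs \<and> hd vs = x \<and> last vs = y \<and> (\<forall>v\<in>set vs. \<omega> v) \<and> set vs \<subseteq> A)"

text \<open>
  Only parameters \<open>p\<close> in \<open>{0..1}\<close> are meaningful, as \<open>bernoulli_pmf\<close> truncates \<open>p\<close> to that interval.
\<close>

definition site_percolation :: "real \<Rightarrow> 'd::finite config measure" where
  "site_percolation p = (\<Pi>\<^sub>M v\<in>UNIV. measure_pmf (bernoulli_pmf p))"

definition has_infinite_cluster :: "'d::finite config \<Rightarrow> bool" where
  "has_infinite_cluster \<omega> \<longleftrightarrow>
     (\<exists>C. infinite C \<and> connected_sites C \<and> (\<forall>v\<in>C. \<omega> v))"

definition critical_prob :: "'d::finite itself \<Rightarrow> real" where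
  "critical_prob _ =
     Sup {p \<in> {0..1}. \<P>(\<omega> in (site_percolation p :: 'd config measure). has_infinite_cluster \<omega>) = 0}"

end

theory Submission
  imports Defs
begin

text \<open>
  If the expected number of exits from some finite set \<open>S\<close> around \<open>0\<close> (the exit sum) is less than 1,
  then connection probabilities decay exponentially; as the exit sum is a polynomial in \<open>p\<close>, it is
  therefore at least 1 at \<open>p\<^sub>c\<close> for every connected \<open>S\<close>. Hence the component of \<open>0\<close> among the sites
  \<open>z\<close> of \<open>\<Lambda>(n)\<close> with \<open>P(0 \<leftrightarrow> z in \<Lambda>(n)) \<ge> p\<^sub>c / (2n+1)\<^sup>d\<close> reaches the boundary of \<open>\<Lambda>(n)\<close>, which
  gives a path of good sites from \<open>0\<close> to norm \<open>n\<close>.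

  Let \<open>n = \<parallel>x\<parallel>\<close>. By the FKG inequality it suffices to reach \<open>x\<close> up to a bounded error by \<open>d\<close> steps,
  each a signed coordinate permutation of a good site. Permute the path so that for step \<open>j\<close>
  coordinate \<open>j\<close> runs from \<open>0\<close> to \<open>n\<close>. The signs of the coordinates of all steps are free, so in
  coordinate \<open>i\<close> one may walk from \<open>0\<close> by the steps \<open>j < i\<close>, and backwards from \<open>x\<^sub>i\<close> by the steps
  \<open>j > i\<close>, always towards the origin and up to sign. This keeps the absolute values \<open>A\<^sub>i\<close> and \<open>B\<^sub>i\<close>
  of both ends in \<open>[0, n]\<close>, and step \<open>i\<close> has to cover \<open>\<bar>B\<^sub>i - A\<^sub>i\<bar>\<close>. The resulting \<open>d\<close> equations for
  the \<open>d\<close> positions on the paths are solved by Brouwer's theorem.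
\<close>

section \<open>Finite Bernoulli expectations\<close>

text \<open>Expectation over the random set of open sites of \<open>V\<close>. It is a finite sum
  and a polynomial in \<open>p\<close>, so almost all estimates below need no measure
  theory.\<close>

definition bern_expect :: "real \<Rightarrow> 'a set \<Rightarrow> ('a set \<Rightarrow> real) \<Rightarrow> real" where
  "bern_expect p V f = (\<Sum>T\<in>Pow V. p ^ card T * (1 - p) ^ card (V - T) * f T)"

lemma bern_expect_empty [simp]: "bern_expect p {} f = f {}"
  by (simp add: bern_expect_def)

lemma bern_expect_cong:
  assumes "\<And>T. T \<subseteq> V \<Longrightarrow> f T = g T"
  shows "bern_expect p V f = bern_expect p V g"
  unfolding bern_expect_def using assms by (intro sum.cong) auto

lemma bern_expect_insert:
  assumes "finite V" "v \<notin> V"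
  shows "bern_expect p (insert v V) f =
    (1 - p) * bern_expect p V f + p * bern_expect p V (\<lambda>T. f (insert v T))"
proof -
  let ?w = "\<lambda>T. p ^ card T * (1 - p) ^ card (insert v V - T) * f T"
  have fin: "finite T" if "T \<subseteq> V" for T
    using assms(1) that finite_subset by blast
  have inj: "inj_on (insert v) (Pow V)"
    using assms(2) by (auto simp: inj_on_def)
  have "bern_expect p (insert v V) f = sum ?w (Pow V) + sum ?w (insert v ` Pow V)"
    unfolding bern_expect_def Pow_insert
    using assms by (intro sum.union_disjoint) auto
  also have "sum ?w (Pow V) = (1 - p) * bern_expect p V f"
    unfolding bern_expect_def sum_distrib_left
  proof (intro sum.cong refl)
    fix T assume "T \<in> Pow V"
    then have "insert v V - T = insert v (V - T)" "v \<notin> V - T" "finite (V - T)"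
      using assms by auto
    then show "?w T = (1 - p) * (p ^ card T * (1 - p) ^ card (V - T) * f T)"
      by simp
  qed
  also have "sum ?w (insert v ` Pow V) = p * bern_expect p V (\<lambda>T. f (insert v T))"
    unfolding bern_expect_def sum_distrib_left sum.reindex[OF inj] o_def
  proof (intro sum.cong refl)
    fix T assume "T \<in> Pow V"
    then have "insert v V - insert v T = V - T" "card (insert v T) = Suc (card T)"
      using assms(2) fin by (auto intro!: card_insert_disjoint)
    then show "?w (insert v T) = p * (p ^ card T * (1 - p) ^ card (V - T) * f (insert v T))"
      by simp
  qed
  finally show ?thesis .
qed

lemma bern_expect_add:
  "bern_expect p V (\<lambda>T. f T + g T) = bern_expect p V f + bern_expect p V g"
  by (simp add: bern_expect_def distrib_left sum.distrib)

lemma bern_expect_cmult: "bern_expect p V (\<lambda>T. a * f T) = a * bern_expect p V f"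
  by (simp add: bern_expect_def sum_distrib_left mult_ac)

lemma bern_expect_sum:
  "bern_expect p V (\<lambda>T. \<Sum>i\<in>I. f i T) = (\<Sum>i\<in>I. bern_expect p V (f i))"
  unfolding bern_expect_def sum_distrib_left by (rule sum.swap)

lemma bern_expect_mono:
  assumes "p \<in> {0..1}" "\<And>T. T \<subseteq> V \<Longrightarrow> f T \<le> g T"
  shows "bern_expect p V f \<le> bern_expect p V g"
  unfolding bern_expect_def using assms by (intro sum_mono mult_left_mono) auto

lemma bern_expect_const [simp]:
  assumes "finite V"
  shows "bern_expect p V (\<lambda>_. a) = a"
  using assms by (induction V) (auto simp: bern_expect_insert algebra_simps)

lemma bern_expect_nonneg:
  assumes "p \<in> {0..1}" "\<And>T. T \<subseteq> V \<Longrightarrow> 0 \<le> f T"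
  shows "0 \<le> bern_expect p V f"
  unfolding bern_expect_def using assms by (intro sum_nonneg) auto

lemma bern_expect_union:
  assumes "finite J" "finite K" "J \<inter> K = {}"
  shows "bern_expect p (J \<union> K) f = bern_expect p J (\<lambda>A. bern_expect p K (\<lambda>B. f (A \<union> B)))"
  using assms(2,1,3)
proof (induction K arbitrary: f rule: finite_induct)
  case (insert k K)
  have "bern_expect p (J \<union> insert k K) f = bern_expect p (insert k (J \<union> K)) f"
    by simp
  also have "\<dots> = (1 - p) * bern_expect p (J \<union> K) f
      + p * bern_expect p (J \<union> K) (\<lambda>T. f (insert k T))"
    using insert by (intro bern_expect_insert) auto
  also have "\<dots> = bern_expect p J (\<lambda>A. (1 - p) * bern_expect p K (\<lambda>B. f (A \<union> B))
      + p * bern_expect p K (\<lambda>B. f (insert k (A \<union> B))))"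
    using insert by (simp add: bern_expect_add bern_expect_cmult)
  also have "\<dots> = bern_expect p J (\<lambda>A. bern_expect p (insert k K) (\<lambda>B. f (A \<union> B)))"
    using insert by (simp add: bern_expect_insert)
  finally show ?case .
qed simp

lemma bern_expect_indep:
  assumes "finite J" "finite K" "J \<inter> K = {}"
  shows "bern_expect p (J \<union> K) (\<lambda>T. f (T \<inter> J) * g (T \<inter> K)) =
    bern_expect p J f * bern_expect p K g"
proof -
  have "bern_expect p (J \<union> K) (\<lambda>T. f (T \<inter> J) * g (T \<inter> K)) =
    bern_expect p J (\<lambda>A. bern_expect p K (\<lambda>B. f A * g B))"
    unfolding bern_expect_union[OF assms]
  proof (intro bern_expect_cong)
    fix A B assume "A \<subseteq> J" "B \<subseteq> K"
    then have "(A \<union> B) \<inter> J = A" "(A \<union> B) \<inter> K = B"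
      using assms(3) by auto
    then show "f ((A \<union> B) \<inter> J) * g ((A \<union> B) \<inter> K) = f A * g B"
      by simp
  qed
  then show ?thesis
    by (simp add: bern_expect_cmult mult.commute[of _ "bern_expect p K g"])
qed

lemma bern_expect_marginal:
  assumes "finite V" "J \<subseteq> V"
  shows "bern_expect p V (\<lambda>T. f (T \<inter> J)) = bern_expect p J f"
proof -
  have "finite J" "V = J \<union> (V - J)"
    using assms finite_subset by auto
  then show ?thesis
    using bern_expect_indep[of J "V - J" p f "\<lambda>_. 1"] assms(1) by simp
qed

lemma bern_expect_image:
  assumes "inj_on \<sigma> V"
  shows "bern_expect p (\<sigma> ` V) f = bern_expect p V (\<lambda>T. f (\<sigma> ` T))"
proof -
  have inj: "inj_on (image \<sigma>) (Pow V)"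
    using assms by (rule inj_on_image_Pow)
  have "card (\<sigma> ` T) = card T" "card (\<sigma> ` V - \<sigma> ` T) = card (V - T)" if "T \<subseteq> V" for T
  proof -
    show "card (\<sigma> ` T) = card T"
      using assms that by (meson card_image inj_on_subset)
    have "\<sigma> ` V - \<sigma> ` T = \<sigma> ` (V - T)"
      using assms that by (simp add: inj_on_image_set_diff)
    then show "card (\<sigma> ` V - \<sigma> ` T) = card (V - T)"
      using assms by (metis Diff_subset card_image inj_on_subset)
  qed
  then show ?thesis
    unfolding bern_expect_def image_Pow_surj[OF refl, of \<sigma> V, symmetric] sum.reindex[OF inj]
    by (intro sum.cong) auto
qed

text \<open>Harris (FKG) inequality. Conditioning on the state of \<open>v\<close> gives two smaller
  instances, and both conditional expectations increase when \<open>v\<close> opens.\<close>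

lemma bern_expect_Harris:
  assumes "p \<in> {0..1}" "finite V" "mono f" "mono g"
  shows "bern_expect p V f * bern_expect p V g \<le> bern_expect p V (\<lambda>T. f T * g T)"
  using assms(2-4)
proof (induction V arbitrary: f g rule: finite_induct)
  case (insert v V)
  have m: "mono (\<lambda>T. h (insert v T))" if "mono h" for h :: "'a set \<Rightarrow> real"
    using that by (intro monoI) (auto intro: monoD)
  define F0 F1 G0 G1 where "F0 = bern_expect p V f" "F1 = bern_expect p V (\<lambda>T. f (insert v T))"
    and "G0 = bern_expect p V g" "G1 = bern_expect p V (\<lambda>T. g (insert v T))"
  note defs = this
  have "F0 \<le> F1" "G0 \<le> G1"
    unfolding defs using assms(1) insert.prems
    by (auto intro!: bern_expect_mono simp: mono_def subset_insertI)
  \<comment> \<open>Chebyshev's inequality on a two-point space: this product is the difference of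
    the two sides of the next inequality.\<close>
  then have "0 \<le> p * (1 - p) * ((F1 - F0) * (G1 - G0))"
    using assms(1) by simp
  then have "((1 - p) * F0 + p * F1) * ((1 - p) * G0 + p * G1) \<le> (1 - p) * (F0 * G0) + p * (F1 * G1)"
    by (simp add: algebra_simps)
  also have "\<dots> \<le> (1 - p) * bern_expect p V (\<lambda>T. f T * g T)
      + p * bern_expect p V (\<lambda>T. f (insert v T) * g (insert v T))"
    unfolding defs using assms(1) insert.IH[OF insert.prems]
      insert.IH[OF insert.prems[THEN m]]
    by (intro add_mono mult_left_mono) auto
  finally show ?case
    using insert.hyps by (simp add: bern_expect_insert defs)
qed simp

lemma continuous_bern_expect: "continuous_on UNIV (\<lambda>p. bern_expect p V f)"
  unfolding bern_expect_def by (intro continuous_intros)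

section \<open>The percolation measure on events of finitely many sites\<close>

lemma prob_space_site_percolation: "prob_space (site_percolation p)"
  unfolding site_percolation_def by (intro prob_space_PiM measure_pmf.prob_space_axioms)

lemma space_site_percolation [simp]: "space (site_percolation p) = UNIV"
  by (simp add: site_percolation_def space_PiM)

lemma site_percolation_finite_event:
  assumes "finite V"
  shows "{\<omega>. P {v \<in> V. \<omega> v}} \<in> sets (site_percolation p :: 'd::finite config measure)"
    and "p \<in> {0..1} \<Longrightarrow> measure (site_percolation p :: 'd config measure) {\<omega>. P {v \<in> V. \<omega> v}} =
      bern_expect p V (\<lambda>T. of_bool (P T))"
proof -
  let ?M = "\<lambda>v::'d site. measure_pmf (bernoulli_pmf p)"
  let ?S = "site_percolation p :: 'd config measure"
  interpret product_prob_space ?M UNIV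
    by unfold_locales
  interpret S: prob_space ?S
    by (rule prob_space_site_percolation)
  \<comment> \<open>The event is a finite disjoint union of cylinders, one for each admissible
    pattern of open sites in \<open>V\<close>.\<close>
  define Cy where "Cy T = {\<omega>::'d config. {v \<in> V. \<omega> v} = T}" for T
  have Cy: "Cy T = prod_emb UNIV ?M V (\<Pi>\<^sub>E v\<in>V. {v \<in> T})" if "T \<subseteq> V" for T
    using that by (auto simp: Cy_def prod_emb_def space_PiM PiE_def Pi_def fun_eq_iff)
  have Cys: "Cy T \<in> sets ?S" if "T \<subseteq> V" for T
    unfolding Cy[OF that] site_percolation_def using assms by (intro sets_PiM_I) auto
  have Cym: "measure ?S (Cy T) = p ^ card T * (1 - p) ^ card (V - T)"
    if "T \<subseteq> V" "p \<in> {0..1}" for T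
  proof -
    have "measure ?S (Cy T) = (\<Prod>v\<in>V. measure (?M v) {v \<in> T})"
      unfolding Cy[OF that(1)] site_percolation_def using assms
      by (intro measure_PiM_emb) auto
    also have "\<dots> = (\<Prod>v\<in>V. if v \<in> T then p else 1 - p)"
      using that(2) by (intro prod.cong) (auto simp: measure_pmf_single)
    also have "\<dots> = (\<Prod>v\<in>T. p) * (\<Prod>v\<in>V - T. 1 - p)"
      using assms that(1) by (simp add: prod.If_cases Int_absorb1 Diff_eq)
    finally show ?thesis by simp
  qed
  have eq: "{\<omega>. P {v \<in> V. \<omega> v}} = (\<Union>T\<in>{T \<in> Pow V. P T}. Cy T)"
    by (auto simp: Cy_def)
  show "{\<omega>. P {v \<in> V. \<omega> v}} \<in> sets ?S"
    unfolding eq using assms Cys by (intro sets.finite_UN) auto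
  assume p: "p \<in> {0..1}"
  have "measure ?S {\<omega>. P {v \<in> V. \<omega> v}} = (\<Sum>T\<in>{T \<in> Pow V. P T}. measure ?S (Cy T))"
    unfolding eq using assms Cys
    by (intro S.finite_measure_finite_Union) (auto simp: disjoint_family_on_def Cy_def)
  also have "\<dots> = (\<Sum>T\<in>{T \<in> Pow V. P T}. p ^ card T * (1 - p) ^ card (V - T))"
    using Cym p by (intro sum.cong) auto
  also have "\<dots> = (\<Sum>T\<in>Pow V. if P T then p ^ card T * (1 - p) ^ card (V - T) else 0)"
    using assms by (intro sum.inter_filter) auto
  also have "\<dots> = bern_expect p V (\<lambda>T. of_bool (P T))"
    unfolding bern_expect_def by (intro sum.cong) auto
  finally show "measure ?S {\<omega>. P {v \<in> V. \<omega> v}} = bern_expect p V (\<lambda>T. of_bool (P T))" .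
qed

section \<open>Connections and exponential decay\<close>

lemma max_norm_le_iff: "max_norm (x :: 'd::finite site) \<le> m \<longleftrightarrow> (\<forall>i. \<bar>x $ i\<bar> \<le> m)"
  by (auto simp: max_norm_def)

lemma abs_le_max_norm: "\<bar>x $ i\<bar> \<le> max_norm (x :: 'd::finite site)"
  using max_norm_le_iff[of x "max_norm x"] by simp

lemma max_norm_attained: "\<exists>i. \<bar>x $ i\<bar> = max_norm (x :: 'd::finite site)"
proof -
  have "max_norm x \<in> range (\<lambda>i. \<bar>x $ i\<bar>)"
    unfolding max_norm_def by (intro Max_in) auto
  then show ?thesis by auto
qed

lemma max_norm_nonneg [simp]: "0 \<le> max_norm (x :: 'd::finite site)"
  using max_norm_attained[of x] by (metis abs_ge_zero)

lemma max_norm_zero [simp]: "max_norm (0 :: 'd::finite site) = 0"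
  using max_norm_attained[of "0 :: 'd site"] by simp

lemma max_norm_triangle: "max_norm (x + y :: 'd::finite site) \<le> max_norm x + max_norm y"
  unfolding max_norm_le_iff
  using abs_le_max_norm[of x] abs_le_max_norm[of y] by (auto intro: order_trans[OF abs_triangle_ineq add_mono])

lemma in_lattice_box_iff: "x \<in> lattice_box m \<longleftrightarrow> max_norm (x :: 'd::finite site) \<le> m"
proof -
  have "x $ i \<in> {-m..m} \<longleftrightarrow> \<bar>x $ i\<bar> \<le> m" for i
    by auto
  then show ?thesis
    by (simp add: lattice_box_def max_norm_le_iff)
qed

lemma lattice_box_image:
  "(lattice_box m :: 'd::finite site set) = (\<lambda>f. \<chi> i. f i) ` (\<Pi>\<^sub>E i\<in>UNIV. {-m..m})"
proof -
  have "x \<in> (\<lambda>f. \<chi> i. f i) ` (\<Pi>\<^sub>E i\<in>UNIV. {-m..m})" if "x \<in> lattice_box m" for x :: "'d site"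
    using that by (intro image_eqI[of _ _ "($) x"]) (auto simp: lattice_box_def)
  then show ?thesis
    by (auto simp: lattice_box_def PiE_def Pi_def)
qed

lemma finite_lattice_box [simp]: "finite (lattice_box m :: 'd::finite site set)"
  unfolding lattice_box_image by (intro finite_imageI finite_PiE) auto

lemma card_lattice_box_le: "card (lattice_box m :: 'd::finite site set) \<le> nat (2 * m + 1) ^ CARD('d)"
proof -
  have "card (lattice_box m :: 'd site set) \<le> card (\<Pi>\<^sub>E i\<in>(UNIV :: 'd set). {-m..m})"
    unfolding lattice_box_image by (intro card_image_le finite_PiE) auto
  also have "\<dots> = nat (2 * m + 1) ^ CARD('d)"
    by (simp add: card_PiE algebra_simps)
  finally show ?thesis .
qed

section \<open>Nearest neighbours and connections inside a set of sites\<close>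

lemma neighbours_commute: "neighbours x y \<longleftrightarrow> neighbours y x"
  by (simp add: neighbours_def l1_dist_def abs_minus_commute)

lemma neighbours_translate [simp]: "neighbours (v + x) (v + y) \<longleftrightarrow> neighbours x y"
  by (simp add: neighbours_def l1_dist_def)

lemma neighbours_diff_le:
  assumes "neighbours x y"
  shows "\<bar>x $ i - y $ i\<bar> \<le> 1"
proof -
  have "\<bar>x $ i - y $ i\<bar> \<le> (\<Sum>i\<in>UNIV. \<bar>x $ i - y $ i\<bar>)"
    by (intro member_le_sum) auto
  then show ?thesis
    using assms by (simp add: neighbours_def l1_dist_def)
qed

lemma neighbours_max_norm:
  assumes "neighbours x y"
  shows "max_norm (y - x) \<le> 1"
  using neighbours_diff_le[OF assms] by (simp add: max_norm_le_iff abs_minus_commute)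

lemma neighbours_axis: "neighbours x (x + axis i 1)" "neighbours x (x - axis i 1)"
  by (auto simp: neighbours_def l1_dist_def axis_def if_distrib cong: if_cong)

text \<open>\<open>T\<close> plays the role of the set of open sites. Membership of \<open>x\<close>
  is demanded separately because the reflexive closure alone would connect a closed site to
  itself.\<close>

definition conn :: "'d::finite site set \<Rightarrow> 'd site \<Rightarrow> 'd site \<Rightarrow> bool" where
  "conn T x y \<longleftrightarrow> x \<in> T \<and> (\<lambda>a b. a \<in> T \<and> b \<in> T \<and> neighbours a b)\<^sup>*\<^sup>* x y"

lemma conn_refl: "x \<in> T \<Longrightarrow> conn T x x"
  by (simp add: conn_def)

lemma conn_induct [consumes 1, case_names refl step]:
  assumes "conn T x y" "x \<in> T \<Longrightarrow> P x"
    "\<And>y z. conn T x y \<Longrightarrow> P y \<Longrightarrow> y \<in> T \<Longrightarrow> z \<in> T \<Longrightarrow> neighbours y z \<Longrightarrow> P z"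
  shows "P y"
proof -
  have "(\<lambda>a b. a \<in> T \<and> b \<in> T \<and> neighbours a b)\<^sup>*\<^sup>* x y"
    using assms(1) by (simp add: conn_def)
  then show ?thesis
    by (induction rule: rtranclp_induct) (use assms in \<open>auto simp: conn_def\<close>)
qed

lemma conn_in1: "conn T x y \<Longrightarrow> x \<in> T"
  by (simp add: conn_def)

lemma conn_in2: "conn T x y \<Longrightarrow> y \<in> T"
  by (induction rule: conn_induct)

lemma conn_step: "conn T x y \<Longrightarrow> neighbours y z \<Longrightarrow> z \<in> T \<Longrightarrow> conn T x z"
  using conn_in2[of T x y] by (auto simp: conn_def intro: rtranclp.rtrancl_into_rtrancl)

lemma conn_trans: "conn T x y \<Longrightarrow> conn T y z \<Longrightarrow> conn T x z"
  by (auto simp: conn_def)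

lemma conn_mono: "conn T x y \<Longrightarrow> T \<subseteq> U \<Longrightarrow> conn U x y"
  by (induction rule: conn_induct) (auto intro: conn_refl conn_step)

lemma conn_image:
  assumes "conn T x y" "\<And>a b. neighbours a b \<Longrightarrow> neighbours (\<sigma> a) (\<sigma> b)"
  shows "conn (\<sigma> ` T) (\<sigma> x) (\<sigma> y)"
  using assms(1) by (induction rule: conn_induct) (auto intro: conn_refl conn_step assms(2))

lemma conn_cluster:
  assumes "conn T x y"
  shows "conn {z. conn T x z} x y"
  using assms by (induction rule: conn_induct) (auto intro: conn_refl conn_step)

text \<open>Induction along the path keeps only the part after the last visit to \<open>C\<close>: a
  step that leaves \<open>C\<close> starts this part afresh, any other step outside \<open>C\<close>
  prolongs it.\<close>

lemma conn_last_exit: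
  assumes "conn T v y" "v \<in> C" "y \<notin> C"
  shows "\<exists>c\<in>C. \<exists>x. x \<notin> C \<and> neighbours c x \<and> conn (T - C) x y"
  using assms
proof (induction rule: conn_induct)
  case (step y z)
  show ?case
  proof (cases "y \<in> C")
    case True
    then show ?thesis using step by (meson DiffI conn_refl)
  next
    case False
    then show ?thesis using step by (meson DiffI conn_step)
  qed
qed simp

section \<open>Outer boundaries, exit sums and exponential decay\<close>

definition outer_bd :: "'d::finite site set \<Rightarrow> 'd site set" where
  "outer_bd S = {x. x \<notin> S \<and> (\<exists>y\<in>S. neighbours y x)}"

lemma outer_bd_subset_box:
  assumes "S \<subseteq> lattice_box m"
  shows "outer_bd S \<subseteq> lattice_box (m + 1)"
proof
  fix x assume "x \<in> outer_bd S"
  then obtain y where y: "y \<in> S" "neighbours y x"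
    by (auto simp: outer_bd_def)
  have "max_norm x \<le> max_norm y + max_norm (x - y)"
    using max_norm_triangle[of y "x - y"] by simp
  then show "x \<in> lattice_box (m + 1)"
    using y assms neighbours_max_norm[OF y(2)] by (auto simp: in_lattice_box_iff)
qed

lemma finite_subset_box:
  assumes "finite S"
  shows "\<exists>m\<ge>0. S \<subseteq> lattice_box m"
proof (intro exI conjI)
  show "0 \<le> Max (insert 0 (max_norm ` S))"
    using assms by (intro Max_ge) auto
  show "S \<subseteq> lattice_box (Max (insert 0 (max_norm ` S)))"
    using assms by (auto simp: in_lattice_box_iff intro!: Max_ge)
qed

lemma finite_outer_bd: "finite S \<Longrightarrow> finite (outer_bd S)"
  using finite_subset_box outer_bd_subset_box finite_lattice_box finite_subset by metis

text \<open>
  The quantity \<open>\<phi>\<^sub>p(S)\<close> of Duminil-Copin and Tassion, adapted to sites: the exit site need not be open.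
\<close>

definition exit_sum :: "real \<Rightarrow> 'd::finite site set \<Rightarrow> 'd site \<Rightarrow> real" where
  "exit_sum p S v =
    (\<Sum>x\<in>outer_bd S. bern_expect p S (\<lambda>T. of_bool (\<exists>y. neighbours y x \<and> conn T v y)))"

lemma exit_sum_nonneg: "p \<in> {0..1} \<Longrightarrow> 0 \<le> exit_sum p S v"
  unfolding exit_sum_def by (intro sum_nonneg bern_expect_nonneg) auto

lemma exit_sum_translate:
  fixes S :: "'d::finite site set"
  assumes "p \<in> {0..1}"
  shows "exit_sum p ((+) v ` S) v \<le> exit_sum p S 0"
proof -
  have "outer_bd ((+) v ` S) = (+) v ` outer_bd S"
  proof -
    have "x \<in> (+) v ` outer_bd S" if x: "x \<in> outer_bd ((+) v ` S)" for x
    proof (rule image_eqI)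
      show "x = v + (x - v)" by simp
      obtain y where "y \<in> S" "neighbours (v + y) x" "x \<notin> (+) v ` S"
        using x unfolding outer_bd_def by blast
      then show "x - v \<in> outer_bd S"
        using neighbours_translate[of v y "x - v"]
        by (auto simp: outer_bd_def image_iff dest: bspec[of _ _ "x - v"])
    qed
    then show ?thesis
      by (auto simp: outer_bd_def)
  qed
  then have "exit_sum p ((+) v ` S) v = (\<Sum>x\<in>outer_bd S. bern_expect p S
      (\<lambda>T. of_bool (\<exists>y. neighbours y (v + x) \<and> conn ((+) v ` T) v y)))"
    by (simp add: exit_sum_def sum.reindex bern_expect_image)
  also have "\<dots> \<le> exit_sum p S 0"
    unfolding exit_sum_def
  proof (intro sum_mono bern_expect_mono assms)
    fix x T
    have "\<exists>y. neighbours y x \<and> conn T 0 y"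
      if "neighbours y (v + x)" "conn ((+) v ` T) v y" for y
    proof -
      have "conn ((+) (- v) ` (+) v ` T) (- v + v) (- v + y)"
        using that(2) by (rule conn_image) (simp only: neighbours_translate)
      moreover have "neighbours (- v + y) (- v + (v + x))"
        using that(1) by (simp only: neighbours_translate)
      ultimately show ?thesis
        by (auto simp: image_image)
    qed
    then show "of_bool (\<exists>y. neighbours y (v + x) \<and> conn ((+) v ` T) v y)
        \<le> (of_bool (\<exists>y. neighbours y x \<and> conn T 0 y) :: real)"
      by auto
  qed
  finally show ?thesis .
qed

definition reaches_beyond :: "'d::finite site set \<Rightarrow> 'd site \<Rightarrow> int \<Rightarrow> bool" where
  "reaches_beyond T v m \<longleftrightarrow> (\<exists>y. conn T v y \<and> m < max_norm (y - v))"

lemma reaches_beyond_mono: "reaches_beyond T v m \<Longrightarrow> T \<subseteq> U \<Longrightarrow> reaches_beyond U v m"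
  by (auto simp: reaches_beyond_def intro: conn_mono)

text \<open>
  The cluster \<open>C\<close> of \<open>v\<close> inside \<open>S\<close> is determined by the sites of \<open>D C\<close>, while the path
  continues from its last visit to \<open>C\<close> through a site outside \<open>S\<close> and then avoids \<open>D C\<close>. This
  independence replaces the van den Berg--Kesten inequality.
\<close>

lemma reaches_beyond_step:
  fixes S V :: "'d::finite site set"
  assumes p: "p \<in> {0..1}" and V: "finite V" "S \<subseteq> V" and v: "v \<in> S"
    and M: "\<And>x. x \<in> S \<union> outer_bd S \<Longrightarrow> max_norm (x - v) \<le> M" and "0 \<le> m"
    and q: "\<And>W (x :: 'd site). finite W \<Longrightarrow> bern_expect p W (\<lambda>T. of_bool (reaches_beyond T x m)) \<le> q"
  shows "bern_expect p V (\<lambda>T. of_bool (reaches_beyond T v (M + m))) \<le> exit_sum p S v * q"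
proof -
  \<comment> \<open>\<open>CC\<close> lists the possible clusters of \<open>v\<close> in
    \<open>S\<close>. \<open>Q C T\<close> says that the cluster is \<open>C\<close>: its sites are
    open and the sites of \<open>S\<close> next to it are closed, which only inspects
    \<open>D C\<close>.\<close>
  define CC where "CC = {C. C \<subseteq> S \<and> v \<in> C \<and> (\<forall>z\<in>C. conn C v z)}"
  define D where "D C = C \<union> (outer_bd C \<inter> S)" for C
  define Q where "Q C T \<longleftrightarrow> C \<subseteq> T \<and> T \<inter> (outer_bd C \<inter> S) = {}" for C T
  define adj where "adj C x \<longleftrightarrow> (\<exists>c\<in>C. neighbours c x)" for C and x :: "'d site"
  have finS: "finite S"
    using V finite_subset by blast
  have finCC: "finite CC"
    using finS by (intro finite_subset[of CC "Pow S"]) (auto simp: CC_def)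
  have DS: "D C \<subseteq> S" if "C \<in> CC" for C
    using that by (auto simp: D_def CC_def)
  have QD: "Q C (T \<inter> D C) \<longleftrightarrow> Q C T" for C T
    by (auto simp: Q_def D_def)
  have cover: "\<exists>C\<in>CC. \<exists>x\<in>outer_bd S. Q C T \<and> adj C x \<and> reaches_beyond (T \<inter> (V - D C)) x m"
    if T: "T \<subseteq> V" and r: "reaches_beyond T v (M + m)" for T
  proof -
    obtain y where y: "conn T v y" "M + m < max_norm (y - v)"
      using r by (auto simp: reaches_beyond_def)
    define C where "C = {z. conn (T \<inter> S) v z}"
    have CT: "C \<subseteq> T \<inter> S"
      using conn_in2 by (auto simp: C_def)
    have vC: "v \<in> C"
      using conn_in1[OF y(1)] v by (simp add: C_def conn_refl)
    have yC: "y \<notin> C"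
      using M[of y] y(2) \<open>0 \<le> m\<close> CT by auto
    have C: "C \<in> CC"
      using CT vC conn_cluster[of "T \<inter> S" v] by (auto simp: CC_def C_def)
    have bd: "T \<inter> (outer_bd C \<inter> S) = {}"
      by (auto simp: outer_bd_def C_def dest: conn_step[of "T \<inter> S"])
    obtain c x where cx: "c \<in> C" "x \<notin> C" "neighbours c x" "conn (T - C) x y"
      using conn_last_exit[OF y(1) vC yC] by blast
    have "x \<in> T"
      using conn_in1[OF cx(4)] by simp
    \<comment> \<open>If \<open>x\<close> were in \<open>S\<close>, it would be an open site of
      \<open>S\<close> adjacent to \<open>C\<close>, against \<open>bd\<close>.\<close>
    then have "x \<in> outer_bd S"
      using cx bd CT by (auto simp: outer_bd_def)
    moreover have "max_norm (y - v) \<le> max_norm (y - x) + max_norm (x - v)"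
      using max_norm_triangle[of "y - x" "x - v"] by simp
    then have "m < max_norm (y - x)"
      using M[of x] y(2) \<open>x \<in> outer_bd S\<close> by force
    moreover have "T - C \<subseteq> T \<inter> (V - D C)"
      using T bd by (auto simp: D_def)
    ultimately show ?thesis
      using C cx CT bd conn_mono[OF cx(4)]
      by (intro bexI[of _ C] bexI[of _ x]) (auto simp: Q_def adj_def reaches_beyond_def)
  qed
  have "bern_expect p V (\<lambda>T. of_bool (reaches_beyond T v (M + m))) \<le>
    bern_expect p V (\<lambda>T. \<Sum>x\<in>outer_bd S. \<Sum>C\<in>CC. of_bool (Q C (T \<inter> D C) \<and> adj C x) *
      of_bool (reaches_beyond (T \<inter> (V - D C)) x m))"
  proof (intro bern_expect_mono p)
    fix T assume "T \<subseteq> V"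
    define g :: "_ \<Rightarrow> _ \<Rightarrow> real" where "g x C = of_bool (Q C (T \<inter> D C) \<and> adj C x) *
      of_bool (reaches_beyond (T \<inter> (V - D C)) x m)" for x C
    have g0: "0 \<le> g x C" for x C
      by (simp add: g_def)
    have "of_bool (reaches_beyond T v (M + m)) \<le> (\<Sum>x\<in>outer_bd S. \<Sum>C\<in>CC. g x C)"
    proof (cases "reaches_beyond T v (M + m)")
      case True
      then obtain C x where Cx: "C \<in> CC" "x \<in> outer_bd S" "Q C T" "adj C x"
        "reaches_beyond (T \<inter> (V - D C)) x m"
        using cover[OF \<open>T \<subseteq> V\<close>] by blast
      have "1 = g x C"
        using Cx by (simp add: g_def QD)
      also have "\<dots> \<le> (\<Sum>C\<in>CC. g x C)"
        using finCC Cx g0 by (intro member_le_sum) auto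
      also have "\<dots> \<le> (\<Sum>x\<in>outer_bd S. \<Sum>C\<in>CC. g x C)"
        using finite_outer_bd[OF finS] Cx g0
        by (intro member_le_sum[where f = "\<lambda>x. \<Sum>C\<in>CC. g x C"]) (auto intro: sum_nonneg)
      finally show ?thesis using True by simp
    qed (auto intro!: sum_nonneg g0)
    then show "of_bool (reaches_beyond T v (M + m)) \<le> (\<Sum>x\<in>outer_bd S. \<Sum>C\<in>CC.
      of_bool (Q C (T \<inter> D C) \<and> adj C x) * of_bool (reaches_beyond (T \<inter> (V - D C)) x m) :: real)"
      by (simp add: g_def)
  qed
  also have "\<dots> = (\<Sum>x\<in>outer_bd S. \<Sum>C\<in>CC. bern_expect p V (\<lambda>T. of_bool (Q C (T \<inter> D C) \<and> adj C x) *
      of_bool (reaches_beyond (T \<inter> (V - D C)) x m)))"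
    by (simp only: bern_expect_sum)
  also have "\<dots> \<le> (\<Sum>x\<in>outer_bd S. \<Sum>C\<in>CC. bern_expect p S (\<lambda>T. of_bool (Q C T \<and> adj C x)) * q)"
  proof (intro sum_mono)
    fix x C assume C: "C \<in> CC"
    have DV: "finite (D C)" "D C \<union> (V - D C) = V"
      using DS[OF C] V finS finite_subset by auto
    have "bern_expect p V (\<lambda>T. of_bool (Q C (T \<inter> D C) \<and> adj C x) *
        of_bool (reaches_beyond (T \<inter> (V - D C)) x m)) =
      bern_expect p (D C) (\<lambda>T. of_bool (Q C T \<and> adj C x)) *
        bern_expect p (V - D C) (\<lambda>T. of_bool (reaches_beyond T x m))"
      using bern_expect_indep[of "D C" "V - D C" p "\<lambda>T. of_bool (Q C T \<and> adj C x)"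
          "\<lambda>T. of_bool (reaches_beyond T x m)"] DV V by simp
    also have "\<dots> \<le> bern_expect p (D C) (\<lambda>T. of_bool (Q C T \<and> adj C x)) * q"
      by (intro mult_left_mono q finite_Diff V bern_expect_nonneg p) auto
    also have "bern_expect p (D C) (\<lambda>T. of_bool (Q C T \<and> adj C x)) =
        bern_expect p S (\<lambda>T. of_bool (Q C T \<and> adj C x))"
      using bern_expect_marginal[OF finS DS[OF C], of p "\<lambda>T. of_bool (Q C T \<and> adj C x)"]
      by (simp add: QD)
    finally show "bern_expect p V (\<lambda>T. of_bool (Q C (T \<inter> D C) \<and> adj C x) *
        of_bool (reaches_beyond (T \<inter> (V - D C)) x m)) \<le>
      bern_expect p S (\<lambda>T. of_bool (Q C T \<and> adj C x)) * q" .
  qed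
  also have "\<dots> = (\<Sum>x\<in>outer_bd S. bern_expect p S (\<lambda>T. \<Sum>C\<in>CC. of_bool (Q C T \<and> adj C x))) * q"
    by (simp add: bern_expect_sum sum_distrib_right)
  also have "\<dots> \<le> exit_sum p S v * q"
    unfolding exit_sum_def
  proof (intro mult_right_mono sum_mono bern_expect_mono p)
    fix x T assume T: "T \<subseteq> S"
    \<comment> \<open>\<open>Q C T\<close> forces \<open>C\<close> to be the cluster of
      \<open>v\<close> in \<open>T\<close>. Hence the sum over \<open>C\<close> has at most one
      nonzero term and collapses to the exit event.\<close>
    have unique: "C = {z. conn T v z} \<and> (\<exists>y. neighbours y x \<and> conn T v y)"
      if C: "C \<in> CC" and QC: "Q C T" "adj C x" for C
    proof -
      have "z \<in> C" if "conn T v z" for z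
        using that
      proof (induction rule: conn_induct)
        case (step y z)
        then show ?case using QC T by (auto simp: Q_def outer_bd_def)
      qed (use C in \<open>simp add: CC_def\<close>)
      moreover have "conn T v z" if "z \<in> C" for z
        using C QC that by (auto simp: CC_def Q_def intro: conn_mono)
      ultimately show ?thesis
        using QC(2) by (auto simp: adj_def)
    qed
    let ?C = "{z. conn T v z}"
    have "(\<Sum>C\<in>CC. of_bool (Q C T \<and> adj C x)) =
        (\<Sum>C\<in>CC \<inter> {?C}. of_bool (Q C T \<and> adj C x) :: real)"
      using finCC unique by (intro sum.mono_neutral_right) auto
    also have "\<dots> \<le> of_bool (\<exists>y. neighbours y x \<and> conn T v y)"
    proof (cases "?C \<in> CC \<and> Q ?C T \<and> adj ?C x")
      case True
      then have "\<exists>y. neighbours y x \<and> conn T v y"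
        using unique by blast
      then show ?thesis
        using True by (simp add: Int_absorb1)
    next
      case False
      then show ?thesis
        by (cases "?C \<in> CC") simp_all
    qed
    finally show "(\<Sum>C\<in>CC. of_bool (Q C T \<and> adj C x)) \<le>
        (of_bool (\<exists>y. neighbours y x \<and> conn T v y) :: real)" .
  next
    show "0 \<le> q"
      by (rule order_trans[OF bern_expect_nonneg q[of "{}" 0]]) (use p in auto)
  qed
  finally show ?thesis .
qed

text \<open>Iteration of the one-step bound, recentred at each exit site by translating
  \<open>S\<close>: every distance \<open>M\<close> costs one more factor
  \<open>exit_sum p S 0\<close>.\<close>

lemma reaches_beyond_decay:
  fixes S V :: "'d::finite site set"
  assumes p: "p \<in> {0..1}" and S: "finite S" "0 \<in> S" "S \<union> outer_bd S \<subseteq> lattice_box M" and "finite V"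
  shows "bern_expect p V (\<lambda>T. of_bool (reaches_beyond T v (int k * M))) \<le> exit_sum p S 0 ^ k"
  using \<open>finite V\<close>
proof (induction k arbitrary: V v)
  case 0
  have "bern_expect p V (\<lambda>T. of_bool (reaches_beyond T v (int 0 * M))) \<le> bern_expect p V (\<lambda>_. 1)"
    by (intro bern_expect_mono p) auto
  then show ?case using 0 by simp
next
  case (Suc k)
  let ?S = "(+) v ` S" and ?q = "exit_sum p S 0 ^ k"
  have M: "0 \<le> M"
    using S by (auto simp: in_lattice_box_iff dest: order_trans[OF max_norm_nonneg])
  have bd: "max_norm (x - v) \<le> M" if x: "x \<in> ?S \<union> outer_bd ?S" for x
  proof -
    have "x - v \<in> S \<union> outer_bd S"
    proof (cases "x \<in> ?S")
      case False
      then obtain y where y: "y \<in> S" "neighbours (v + y) x"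
        using x by (auto simp: outer_bd_def)
      then have "neighbours y (x - v)"
        using neighbours_translate[of v y "x - v"] by simp
      then show ?thesis
        using y False by (auto simp: outer_bd_def image_iff)
    qed auto
    then show ?thesis
      using S(3) by (auto simp: in_lattice_box_iff)
  qed
  \<comment> \<open>The one-step bound asks for a site set containing the translate of
    \<open>S\<close>, so \<open>V\<close> is enlarged; this can only raise the probability.\<close>
  have "bern_expect p V (\<lambda>T. of_bool (reaches_beyond T v (int (Suc k) * M))) =
    bern_expect p (V \<union> ?S) (\<lambda>T. of_bool (reaches_beyond (T \<inter> V) v (int (Suc k) * M)))"
    using Suc.prems S(1) by (intro bern_expect_marginal[symmetric]) auto
  also have "\<dots> \<le> bern_expect p (V \<union> ?S) (\<lambda>T. of_bool (reaches_beyond T v (int (Suc k) * M)))"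
    by (intro bern_expect_mono p) (auto dest: reaches_beyond_mono[of _ _ _ T for T])
  also have "\<dots> = bern_expect p (V \<union> ?S) (\<lambda>T. of_bool (reaches_beyond T v (M + int k * M)))"
    by (simp add: algebra_simps)
  also have "\<dots> \<le> exit_sum p ?S v * ?q"
    using Suc S M by (intro reaches_beyond_step p bd Suc.IH) auto
  also have "\<dots> \<le> exit_sum p S 0 * ?q"
    using exit_sum_nonneg[OF p] by (intro mult_right_mono exit_sum_translate p zero_le_power) auto
  finally show ?case by simp
qed

text \<open>A site of an infinite cluster reaches beyond every distance, which has probability at
  most \<open>exit_sum p S 0 ^ k\<close> for each \<open>k\<close>. There are only countably many
  sites.\<close>

lemma infinite_cluster_null:
  fixes S :: "'d::finite site set"
  assumes p: "p \<in> {0..1}" and S: "finite S" "0 \<in> S" and less: "exit_sum p S 0 < 1"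
  shows "\<P>(\<omega> in (site_percolation p :: 'd config measure). has_infinite_cluster \<omega>) = 0"
proof -
  let ?P = "site_percolation p :: 'd config measure" and ?\<phi> = "exit_sum p S 0"
  interpret prob_space ?P
    by (rule prob_space_site_percolation)
  obtain M0 where "M0 \<ge> 0" "S \<union> outer_bd S \<subseteq> lattice_box M0"
    using finite_subset_box[of "S \<union> outer_bd S"] finite_outer_bd S by blast
  then obtain M where M: "M \<ge> 1" "S \<union> outer_bd S \<subseteq> lattice_box M"
    by (intro that[of "M0 + 1"]) (fastforce simp: in_lattice_box_iff)+
  \<comment> \<open>Restricting to a box leaves an event of finitely many sites. The union over
    \<open>m\<close> removes the box again, so \<open>N v\<close> says that \<open>v\<close> reaches
    beyond every \<open>k * M\<close>.\<close>
  define E where "E v k m = {\<omega>::'d config. reaches_beyond {u \<in> lattice_box (int m). \<omega> u} v (int k * M)}"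
    for v k and m :: nat
  define N where "N v = (\<Inter>k. \<Union>m. E v k m)" for v
  have E_sets: "E v k m \<in> sets ?P" for v k m
    unfolding E_def by (rule site_percolation_finite_event) simp
  have E_le: "measure ?P (E v k m) \<le> ?\<phi> ^ k" for v k m
    unfolding E_def using reaches_beyond_decay[OF p S M(2)] p
    by (subst site_percolation_finite_event(2)) auto
  have inc: "incseq (E v k)" for v k
    by (auto simp: incseq_def E_def in_lattice_box_iff intro: reaches_beyond_mono)
  have U_le: "measure ?P (\<Union>m. E v k m) \<le> ?\<phi> ^ k" for v k
    using E_sets by (intro LIMSEQ_le_const2[OF finite_Lim_measure_incseq[OF _ inc]] exI allI impI E_le) auto
  have "N v \<in> null_sets ?P" for v
  proof -
    have N_sets: "N v \<in> sets ?P"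
      unfolding N_def using E_sets by auto
    have "measure ?P (N v) \<le> ?\<phi> ^ k" for k
    proof -
      have "measure ?P (N v) \<le> measure ?P (\<Union>m. E v k m)"
        using E_sets by (intro finite_measure_mono sets.countable_UN) (auto simp: N_def)
      then show ?thesis
        using U_le[of v k] by linarith
    qed
    moreover have "(\<lambda>k. ?\<phi> ^ k) \<longlonglongrightarrow> 0"
      using less exit_sum_nonneg[OF p, of S 0] by (intro LIMSEQ_power_zero) simp
    ultimately have "measure ?P (N v) \<le> 0"
      using LIMSEQ_le_const by blast
    then show ?thesis
      using N_sets measure_nonneg[of ?P "N v"] by (intro null_setsI) (auto simp: emeasure_eq_measure)
  qed
  then have null: "(\<Union>v. N v) \<in> null_sets ?P"
    by (intro null_sets_UN) auto
  have "{\<omega>. has_infinite_cluster \<omega>} \<subseteq> (\<Union>v. N v)"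
  proof
    fix \<omega> :: "'d config" assume "\<omega> \<in> {\<omega>. has_infinite_cluster \<omega>}"
    then obtain C where C: "infinite C" "connected_sites C" "\<forall>v\<in>C. \<omega> v"
      by (auto simp: has_infinite_cluster_def)
    then obtain v where v: "v \<in> C"
      by (metis ex_in_conv finite.emptyI)
    have "\<exists>m. \<omega> \<in> E v k m" for k
    proof -
      have "\<not> C \<subseteq> (+) v ` lattice_box (int k * M)"
        using C(1) by (metis finite_imageI finite_lattice_box finite_subset)
      then obtain y where y: "y \<in> C" "y \<notin> (+) v ` lattice_box (int k * M)"
        by blast
      have far: "int k * M < max_norm (y - v)"
      proof (rule ccontr)
        assume "\<not> ?thesis"
        then have "y - v \<in> lattice_box (int k * M)"
          by (simp add: in_lattice_box_iff)
        then show False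
          using y(2) by (metis add_diff_cancel_left' diff_add_cancel add.commute imageI)
      qed
      have "conn C v y"
        using C(2) v y(1) by (auto simp: conn_def connected_sites_def)
      \<comment> \<open>A connection uses finitely many sites, hence lies in some box.\<close>
      then have "\<exists>m::nat. conn (C \<inter> lattice_box (int m)) v y"
      proof (induction rule: conn_induct)
        case refl
        have "v \<in> C \<inter> lattice_box (int (nat (max_norm v)))"
          using refl by (simp add: in_lattice_box_iff)
        then show ?case using conn_refl by blast
      next
        case (step y z)
        then obtain m where m: "conn (C \<inter> lattice_box (int m)) v y" by blast
        let ?m = "max m (nat (max_norm z))"
        have "conn (C \<inter> lattice_box (int ?m)) v y"
          by (rule conn_mono[OF m]) (auto simp: in_lattice_box_iff)
        moreover have "z \<in> C \<inter> lattice_box (int ?m)"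
          using step.hyps by (auto simp: in_lattice_box_iff)
        ultimately have "conn (C \<inter> lattice_box (int ?m)) v z"
          using conn_step step.hyps by blast
        then show ?case by blast
      qed
      then obtain m :: nat where "conn (C \<inter> lattice_box (int m)) v y" by blast
      then have "conn {u \<in> lattice_box (int m). \<omega> u} v y"
        by (rule conn_mono) (use C(3) in auto)
      then show ?thesis
        using far by (auto simp: E_def reaches_beyond_def)
    qed
    then show "\<omega> \<in> (\<Union>v. N v)"
      by (auto simp: N_def)
  qed
  \<comment> \<open>Measurability of this event is left open: a measurable subset of a null set is
    null, and \<open>measure\<close> assigns 0 to a nonmeasurable set by default.\<close>
  then have "{\<omega>. has_infinite_cluster \<omega>} \<in> null_sets ?P" if "{\<omega>. has_infinite_cluster \<omega>} \<in> sets ?P"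
    using null_sets_subset[OF null that] by blast
  then have "measure ?P {\<omega>. has_infinite_cluster \<omega>} = 0"
    by (cases "{\<omega>. has_infinite_cluster \<omega>} \<in> sets ?P")
      (auto simp: measure_notin_sets measure_eq_0_null_sets)
  then show ?thesis by simp
qed

section \<open>Walks with prescribed absolute step lengths\<close>

text \<open>Piecewise linear interpolation of \<open>a 0, ..., a N\<close>. The clamp in summand
  \<open>k\<close> rises from 0 to 1 on \<open>[k, k + 1]\<close> and the increments telescope, so
  continuity is immediate.\<close>

definition interp :: "nat \<Rightarrow> (nat \<Rightarrow> real) \<Rightarrow> real \<Rightarrow> real" where
  "interp N a s = a 0 + (\<Sum>k<N. min 1 (max 0 (s - real k)) * (a (Suc k) - a k))"

lemma continuous_interp [continuous_intros]:
  assumes "continuous_on X f"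
  shows "continuous_on X (\<lambda>x. interp N a (f x))"
  unfolding interp_def using assms by (intro continuous_intros)

lemma interp_eq:
  assumes "m < N" "real m \<le> s" "s \<le> real (Suc m)"
  shows "interp N a s = a m + (s - real m) * (a (Suc m) - a m)"
  using assms(1)
proof (induction N)
  case (Suc N)
  show ?case
  proof (cases "m = N")
    case True
    have "(\<Sum>k<N. min 1 (max 0 (s - real k)) * (a (Suc k) - a k)) = (\<Sum>k<N. a (Suc k) - a k)"
      using True assms(2) by (intro sum.cong) (auto simp: min_def max_def)
    also have "\<dots> = a N - a 0"
      by (rule sum_lessThan_telescope)
    finally show ?thesis
      using True assms by (simp add: interp_def min_def max_def)
  next
    case False
    then have "m < N" "s - real N \<le> 0"
      using Suc.prems assms(3) by auto
    then show ?thesis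
      using Suc.IH by (simp add: interp_def)
  qed
qed simp

lemma interp_0 [simp]: "interp N a 0 = a 0"
  by (simp add: interp_def)

lemma interp_end:
  "interp N a (real N) = a N"
proof (cases N)
  case (Suc m)
  then show ?thesis
    using interp_eq[of m N "real N" a] by simp
qed simp

lemma exists_floor_index:
  assumes "0 \<le> s" "s \<le> real N" "0 < N"
  shows "\<exists>m<N. real m \<le> s \<and> s \<le> real (Suc m)"
proof (cases "s = real N")
  case True
  then show ?thesis
    using assms by (intro exI[of _ "N - 1"]) auto
next
  case False
  then show ?thesis
    using assms by (intro exI[of _ "nat \<lfloor>s\<rfloor>"]) linarith
qed

lemma interp_bounds:
  assumes "0 \<le> s" "s \<le> real N" "0 < N" "\<And>m. m \<le> N \<Longrightarrow> a m \<in> {l..u}"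
  shows "interp N a s \<in> {l..u}"
proof -
  obtain m where m: "m < N" "real m \<le> s" "s \<le> real (Suc m)"
    using exists_floor_index assms by blast
  define r where "r = s - real m"
  have "interp N a s = (1 - r) * a m + r * a (Suc m)"
    using interp_eq[OF m] by (simp add: r_def algebra_simps)
  moreover have "(1 - r) * a m + r * a (Suc m) \<in> {l..u}"
    using convexD_alt[of "{l..u}" "a m" "a (Suc m)" r] assms(4)[of m] assms(4)[of "Suc m"] m
    by (auto simp: r_def)
  ultimately show ?thesis by simp
qed

text \<open>Absolute value of the position of a walk on the line that always steps towards the
  origin, with step lengths \<open>z k\<close>. The distance of two points of \<open>[0, n]\<close>
  is at most \<open>n\<close>, so the walk never leaves that range.\<close>

primrec fold_walk :: "(nat \<Rightarrow> real) \<Rightarrow> real \<Rightarrow> nat \<Rightarrow> real" where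
  "fold_walk z a 0 = a"
| "fold_walk z a (Suc k) = \<bar>fold_walk z a k - z k\<bar>"

lemma fold_walk_bounds:
  assumes "a \<in> {0..n}" "\<And>k. k < m \<Longrightarrow> z k \<in> {0..n}"
  shows "fold_walk z a m \<in> {0..n}"
  using assms(2)
proof (induction m)
  case (Suc m)
  then have "fold_walk z a m \<in> {0..n}" "z m \<in> {0..n}"
    by auto
  then show ?case
    by auto
qed (use assms(1) in simp)

lemma continuous_fold_walk:
  assumes "\<And>k. k < m \<Longrightarrow> continuous_on X (\<lambda>t. z t k)"
  shows "continuous_on X (\<lambda>t. fold_walk (z t) a m)"
  using assms by (induction m) (auto intro!: continuous_intros)

text \<open>A signed walk realising the folded one. Its final position is kept nonnegative, at the
  price of fixing the start only up to sign.\<close>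

lemma fold_walk_unfold:
  assumes "a \<in> {0..n}" "\<And>k. k < m \<Longrightarrow> z k \<in> {0..n}"
  shows "\<exists>P. \<bar>P 0\<bar> = a \<and> P m = fold_walk z a m \<and> (\<forall>k<m. \<bar>P (Suc k) - P k\<bar> = z k) \<and>
    (\<forall>k\<le>m. \<bar>P k\<bar> \<le> n)"
  using assms(2)
proof (induction m)
  case 0
  then show ?case
    using assms(1) by (intro exI[of _ "\<lambda>_. a"]) auto
next
  case (Suc m)
  from Suc obtain P where P: "\<bar>P 0\<bar> = a" "P m = fold_walk z a m"
    "\<forall>k<m. \<bar>P (Suc k) - P k\<bar> = z k" "\<forall>k\<le>m. \<bar>P k\<bar> \<le> n"
    by auto
  \<comment> \<open>If the new step overshoots the origin, the whole walk so far is reflected: a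
    step to the right from \<open>- P m\<close> then ends at \<open>z m - P m\<close>, which is
    nonnegative.\<close>
  define s :: real where "s = (if z m \<le> P m then 1 else -1)"
  define Q where "Q k = (if k \<le> m then s * P k else fold_walk z a (Suc m))" for k
  have b: "fold_walk z a (Suc m) \<in> {0..n}" "z m \<ge> 0"
    using fold_walk_bounds[OF assms(1), of "Suc m" z] Suc.prems by auto
  have "\<bar>Q (Suc k) - Q k\<bar> = z k" if "k < Suc m" for k
  proof (cases "k = m")
    case True
    then show ?thesis
      using P(2) b(2) by (auto simp: Q_def s_def)
  next
    case False
    then have "\<bar>P (Suc k) - P k\<bar> = z k" "Suc k \<le> m"
      using P(3) that by auto
    then show ?thesis
      by (auto simp: Q_def s_def abs_minus_commute)
  qed
  moreover have "\<bar>Q 0\<bar> = a" "Q (Suc m) = fold_walk z a (Suc m)"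
    using P(1) by (auto simp: Q_def s_def)
  moreover have "\<bar>Q k\<bar> \<le> n" if "k \<le> Suc m" for k
    using P(4) b(1) by (auto simp: Q_def s_def)
  ultimately show ?case by blast
qed

text \<open>A walk from 0 uses the steps before \<open>j\<close>, and a walk from \<open>x\<close>,
  traversed backwards, uses those after \<open>j\<close>. By \<open>eq\<close>, step
  \<open>j\<close> is exactly as long as the gap between their ends.\<close>

lemma glue_walks:
  assumes x: "\<bar>x\<bar> \<le> n" and z: "\<And>k. k < d \<Longrightarrow> z k \<in> {0..n}" and j: "j < d"
    and eq: "z j = \<bar>fold_walk (\<lambda>k. z (d - Suc k)) \<bar>x\<bar> (d - Suc j) - fold_walk z 0 j\<bar>"
  shows "\<exists>y::nat \<Rightarrow> real. y 0 = 0 \<and> y d = x \<and> (\<forall>k\<le>d. \<bar>y k\<bar> \<le> n) \<and>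
    (\<forall>k<d. \<bar>y (Suc k) - y k\<bar> = z k)"
proof -
  have n: "0 \<le> n"
    using x by linarith
  obtain P where P: "\<bar>P 0\<bar> = 0" "P j = fold_walk z 0 j"
    "\<forall>k<j. \<bar>P (Suc k) - P k\<bar> = z k" "\<forall>k\<le>j. \<bar>P k\<bar> \<le> n"
    using fold_walk_unfold[of 0 n j z] n z j by auto
  obtain Q where Q: "\<bar>Q 0\<bar> = \<bar>x\<bar>" "Q (d - Suc j) = fold_walk (\<lambda>k. z (d - Suc k)) \<bar>x\<bar> (d - Suc j)"
    "\<forall>k<d - Suc j. \<bar>Q (Suc k) - Q k\<bar> = z (d - Suc k)" "\<forall>k\<le>d - Suc j. \<bar>Q k\<bar> \<le> n"
    using fold_walk_unfold[of "\<bar>x\<bar>" n "d - Suc j" "\<lambda>k. z (d - Suc k)"] x z j by auto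
  \<comment> \<open>The unfolded walk starts at \<open>x\<close> or \<open>- x\<close>. Reflecting
    the whole glued walk by \<open>s\<close> corrects this and leaves its other end at 0.\<close>
  obtain s :: real where s: "s = 1 \<or> s = -1" "s * Q 0 = x"
    using Q(1) by (metis abs_eq_iff mult_1 mult_minus1)
  define R where "R k = (if k \<le> j then P k else Q (d - k))" for k
  have R: "\<bar>R (Suc k) - R k\<bar> = z k" if "k < d" for k
  proof -
    consider "k < j" | "k = j" | "j < k" by linarith
    then show ?thesis
    proof cases
      case 1 then show ?thesis using P(3) by (auto simp: R_def)
    next
      case 2 then show ?thesis using P(2) Q(2) eq by (auto simp: R_def)
    next
      case 3
      have "\<bar>Q (Suc (d - Suc k)) - Q (d - Suc k)\<bar> = z (d - Suc (d - Suc k))"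
        using Q(3) 3 that by auto
      moreover have "Suc (d - Suc k) = d - k" "d - Suc (d - Suc k) = k"
        using that by auto
      ultimately show ?thesis
        using 3 by (simp add: R_def abs_minus_commute)
    qed
  qed
  define y where "y k = s * R k" for k
  have "y 0 = 0" "y d = x"
    using P(1) s(2) j by (auto simp: y_def R_def)
  moreover have "\<bar>y k\<bar> \<le> n" if "k \<le> d" for k
    using s(1) P(4) Q(4) that by (auto simp: y_def R_def abs_mult)
  moreover have "\<bar>y (Suc k) - y k\<bar> = z k" if "k < d" for k
    using s(1) R[OF that] by (auto simp: y_def abs_minus_commute)
  ultimately show ?thesis by blast
qed

text \<open>Poincare-Miranda from Brouwer, applied to the map that moves \<open>t\<close> by
  \<open>H - f\<close> and truncates to the cube. At a fixed point, truncation can act only on a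
  face, where the sign condition still forces equality.\<close>

lemma poincare_miranda_cbox:
  fixes f H :: "'d::finite \<Rightarrow> real ^ 'd \<Rightarrow> real"
  assumes L: "0 \<le> L"
    and f: "\<And>i. continuous_on (cbox 0 (\<chi> i. L)) (f i)"
    and H: "\<And>i. continuous_on (cbox 0 (\<chi> i. L)) (H i)"
    and lo: "\<And>i t. t \<in> cbox 0 (\<chi> i. L) \<Longrightarrow> t $ i = 0 \<Longrightarrow> f i t \<le> H i t"
    and hi: "\<And>i t. t \<in> cbox 0 (\<chi> i. L) \<Longrightarrow> t $ i = L \<Longrightarrow> H i t \<le> f i t"
  shows "\<exists>t \<in> cbox 0 (\<chi> i. L). \<forall>i. f i t = H i t"
proof -
  let ?C = "cbox 0 (\<chi> i. L) :: (real ^ 'd) set"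
  define F :: "real ^ 'd \<Rightarrow> real ^ 'd"
    where "F t = (\<chi> i. min L (max 0 (t $ i - (f i t - H i t))))" for t
  have "continuous_on ?C F"
    unfolding F_def by (intro continuous_intros f H)
  moreover have "F \<in> ?C \<rightarrow> ?C"
    using L by (auto simp: F_def mem_box_cart)
  moreover have "compact ?C" "convex ?C" "?C \<noteq> {}"
    using L by (auto simp: interval_ne_empty_cart convex_box)
  ultimately obtain t where t: "t \<in> ?C" "F t = t"
    using brouwer by metis
  have "f i t = H i t" for i
  proof -
    have "t $ i = min L (max 0 (t $ i - (f i t - H i t)))" "0 \<le> t $ i" "t $ i \<le> L"
      using t by (auto simp: F_def vec_eq_iff mem_box_cart)
    then show ?thesis
      using lo[OF t(1), of i] hi[OF t(1), of i] by (auto simp: min_def max_def split: if_splits)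
  qed
  with t(1) show ?thesis by blast
qed

text \<open>The unknown \<open>t j\<close> is the position on path \<open>j\<close>. In coordinate
  \<open>i\<close> the step belonging to path \<open>i\<close> must bridge the gap
  \<open>\<bar>B i t - A i t\<bar>\<close>. Its length runs from 0 to \<open>n\<close> along the
  path while the gap stays in \<open>[0, n]\<close>: these are the face conditions of
  Poincare-Miranda.\<close>

lemma walk_exists:
  fixes h :: "'d::finite \<Rightarrow> 'd \<Rightarrow> real \<Rightarrow> real" and x :: "'d \<Rightarrow> real"
  assumes L: "0 \<le> L" and e: "bij_betw e {..<CARD('d)} UNIV"
    and cont: "\<And>j i. continuous_on {0..L} (h j i)"
    and bd: "\<And>j i s. s \<in> {0..L} \<Longrightarrow> h j i s \<in> {0..n}"
    and h0: "\<And>j. h j j 0 = 0" and hL: "\<And>j. h j j L = n"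
    and x: "\<And>i. \<bar>x i\<bar> \<le> n"
  shows "\<exists>t y. (\<forall>j. t j \<in> {0..L}) \<and> (\<forall>i. y 0 i = 0 \<and> y CARD('d) i = x i \<and>
    (\<forall>k\<le>CARD('d). \<bar>y k i\<bar> \<le> n) \<and>
    (\<forall>k<CARD('d). \<bar>y (Suc k) i - y k i\<bar> = h (e k) i (t (e k))))"
proof -
  let ?d = "CARD('d)" and ?C = "cbox 0 (\<chi> i. L) :: (real ^ 'd) set"
  define idx where "idx = inv_into {..<?d} e"
  have idx: "idx i < ?d" "e (idx i) = i" for i
    using bij_betwE[OF bij_betw_inv_into[OF e]] bij_betw_inv_into_right[OF e]
    by (auto simp: idx_def)
  define z where "z i t k = h (e k) i (t $ e k)" for i and t :: "real ^ 'd" and k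
  define A where "A i t = fold_walk (z i t) 0 (idx i)" for i t
  define B where "B i t = fold_walk (\<lambda>k. z i t (?d - Suc k)) \<bar>x i\<bar> (?d - Suc (idx i))" for i t
  have zc: "continuous_on ?C (\<lambda>t. z i t k)" for i k
    unfolding z_def
    by (rule continuous_on_compose2[OF cont]) (auto intro!: continuous_intros simp: mem_box_cart)
  have zb: "z i t k \<in> {0..n}" if "t \<in> ?C" for i t k
    using that bd by (auto simp: z_def mem_box_cart)
  have Hc: "continuous_on ?C (\<lambda>t. \<bar>B i t - A i t\<bar>)" for i
    unfolding A_def B_def by (intro continuous_intros continuous_fold_walk zc)
  have n: "0 \<le> n"
    using x by (meson abs_ge_zero order_trans)
  have Hb: "\<bar>B i t - A i t\<bar> \<le> n" if "t \<in> ?C" for i t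
  proof -
    have "A i t \<in> {0..n}" "B i t \<in> {0..n}"
      unfolding A_def B_def using zb[OF that] x n by (intro fold_walk_bounds; simp)+
    then show ?thesis by (auto simp: abs_if)
  qed
  have "continuous_on ?C (\<lambda>t. z i t (idx i))" for i
    by (rule zc)
  then have "continuous_on ?C (\<lambda>t. h i i (t $ i))" for i
    by (simp add: z_def idx)
  then have "\<exists>t\<in>?C. \<forall>i. z i t (idx i) = \<bar>B i t - A i t\<bar>"
    using L Hc Hb h0 hL by (intro poincare_miranda_cbox) (auto simp: z_def idx)
  then obtain t where t: "t \<in> ?C" "\<And>i. z i t (idx i) = \<bar>B i t - A i t\<bar>"
    by blast
  have "\<forall>i. \<exists>y::nat \<Rightarrow> real. y 0 = 0 \<and> y ?d = x i \<and> (\<forall>k\<le>?d. \<bar>y k\<bar> \<le> n) \<and>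
    (\<forall>k<?d. \<bar>y (Suc k) - y k\<bar> = z i t k)"
  proof
    fix i
    show "\<exists>y::nat \<Rightarrow> real. y 0 = 0 \<and> y ?d = x i \<and> (\<forall>k\<le>?d. \<bar>y k\<bar> \<le> n) \<and>
      (\<forall>k<?d. \<bar>y (Suc k) - y k\<bar> = z i t k)"
      using t(2)[of i] unfolding A_def B_def by (intro glue_walks[OF x zb[OF t(1)] idx(1)])
  qed
  then obtain y where "\<forall>i. y i 0 = 0 \<and> y i ?d = x i \<and> (\<forall>k\<le>?d. \<bar>y i k\<bar> \<le> n) \<and>
    (\<forall>k<?d. \<bar>y i (Suc k) - y i k\<bar> = z i t k)"
    by metis
  then show ?thesis
    using t(1) by (intro exI[of _ "\<lambda>j. t $ j"] exI[of _ "\<lambda>k i. y i k"]) (auto simp: z_def mem_box_cart)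
qed

text \<open>Rounds the real solution to lattice points of the paths. All coordinates of a step share
  one index \<open>\<mu>\<close>, so each step remains a vector of its path up to signs; every step
  adds an error of at most 1 per coordinate.\<close>

lemma lattice_walk_exists:
  fixes a :: "'d::finite \<Rightarrow> 'd \<Rightarrow> nat \<Rightarrow> int" and x :: "'d site"
  assumes N: "0 < N" and e: "bij_betw e {..<CARD('d)} UNIV"
    and bd: "\<And>j i m. m \<le> N \<Longrightarrow> a j i m \<in> {0..n}"
    and step: "\<And>j i m. m < N \<Longrightarrow> \<bar>a j i (Suc m) - a j i m\<bar> \<le> 1"
    and a0: "\<And>j. a j j 0 = 0" and aN: "\<And>j. a j j N = n"
    and x: "\<And>i. \<bar>x $ i\<bar> \<le> n"
  shows "\<exists>(\<mu> :: 'd \<Rightarrow> nat) y. (\<forall>j. \<mu> j \<le> N) \<and> y 0 = (0 :: 'd site) \<and>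
    (\<forall>i. \<bar>y CARD('d) $ i - x $ i\<bar> \<le> int CARD('d)) \<and>
    (\<forall>k\<le>CARD('d). \<forall>i. \<bar>y k $ i\<bar> \<le> n + int CARD('d)) \<and>
    (\<forall>k<CARD('d). \<forall>i. \<bar>y (Suc k) $ i - y k $ i\<bar> = a (e k) i (\<mu> (e k)))"
proof -
  define h where "h j i = interp N (\<lambda>m. real_of_int (a j i m))" for j i
  have "\<exists>t y. (\<forall>j. t j \<in> {0..real N}) \<and> (\<forall>i. y 0 i = 0 \<and> y CARD('d) i = real_of_int (x $ i) \<and>
    (\<forall>k\<le>CARD('d). \<bar>y k i\<bar> \<le> real_of_int n) \<and>
    (\<forall>k<CARD('d). \<bar>y (Suc k) i - y k i\<bar> = h (e k) i (t (e k))))"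
  proof (rule walk_exists[OF _ e])
    show "continuous_on {0..real N} (h j i)" for j i
      unfolding h_def by (intro continuous_intros)
    show "h j i s \<in> {0..real_of_int n}" if "s \<in> {0..real N}" for j i s
      unfolding h_def using that N bd by (intro interp_bounds) auto
    show "h j j (real N) = real_of_int n" for j
      by (simp add: h_def interp_end aN)
    show "\<bar>real_of_int (x $ i)\<bar> \<le> real_of_int n" for i
      using x[of i] by linarith
  qed (auto simp: h_def a0)
  then obtain t y where t: "\<And>j. t j \<in> {0..real N}" and y: "\<And>i. y 0 i = 0"
    "\<And>i. y CARD('d) i = real_of_int (x $ i)"
    "\<And>k i. k \<le> CARD('d) \<Longrightarrow> \<bar>y k i\<bar> \<le> real_of_int n"
    "\<And>k i. k < CARD('d) \<Longrightarrow> \<bar>y (Suc k) i - y k i\<bar> = h (e k) i (t (e k))"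
    by blast
  have "\<exists>m\<le>N. \<forall>i. \<bar>h j i (t j) - real_of_int (a j i m)\<bar> \<le> 1" for j
  proof -
    obtain m where m: "m < N" "real m \<le> t j" "t j \<le> real (Suc m)"
      using exists_floor_index[of "t j" N] t[of j] N by auto
    have "\<bar>h j i (t j) - real_of_int (a j i m)\<bar> \<le> 1" for i
    proof -
      have "\<bar>real_of_int (a j i (Suc m)) - real_of_int (a j i m)\<bar> \<le> 1"
        using step[OF m(1), of j i] by linarith
      then have "\<bar>t j - real m\<bar> * \<bar>real_of_int (a j i (Suc m)) - real_of_int (a j i m)\<bar> \<le> 1"
        using m by (intro mult_le_one) auto
      then show ?thesis
        unfolding h_def interp_eq[OF m] by (simp add: abs_mult)
    qed
    then show ?thesis using m(1) less_imp_le by blast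
  qed
  then obtain \<mu> where \<mu>: "\<And>j. \<mu> j \<le> N"
    "\<And>j i. \<bar>h j i (t j) - real_of_int (a j i (\<mu> j))\<bar> \<le> 1"
    by metis
  \<comment> \<open>The integer walk copies the signs of the real walk, so only the step lengths
    differ.\<close>
  define sg :: "nat \<Rightarrow> 'd \<Rightarrow> int" where "sg k i = (if y k i \<le> y (Suc k) i then 1 else -1)" for k i
  define u :: "nat \<Rightarrow> 'd site" where
    "u k = (\<chi> i. \<Sum>l<k. sg l i * a (e l) i (\<mu> (e l)))" for k
  have err: "\<bar>real_of_int (u k $ i) - y k i\<bar> \<le> real k" if "k \<le> CARD('d)" for k i
    using that
  proof (induction k)
    case (Suc k)
    have "y (Suc k) i - y k i = sg k i * h (e k) i (t (e k))"
      using y(4)[of k i] Suc.prems by (auto simp: sg_def)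
    moreover have "\<bar>sg k i * h (e k) i (t (e k)) - sg k i * a (e k) i (\<mu> (e k))\<bar> \<le> 1"
      using \<mu>(2)[of "e k" i] by (auto simp: sg_def)
    moreover have "\<bar>real_of_int (u k $ i) - y k i\<bar> \<le> real k"
      using Suc by simp
    moreover have "real_of_int (u (Suc k) $ i) =
        real_of_int (u k $ i) + sg k i * a (e k) i (\<mu> (e k))"
      by (simp add: u_def)
    ultimately show ?case by (simp add: abs_if split: if_splits)
  qed (simp add: u_def y(1))
  have "\<bar>u CARD('d) $ i - x $ i\<bar> \<le> int CARD('d)" for i
    using err[of "CARD('d)" i] y(2)[of i] by linarith
  moreover have "\<bar>u k $ i\<bar> \<le> n + int CARD('d)" if "k \<le> CARD('d)" for k i
    using err[OF that, of i] y(3)[OF that, of i] that by linarith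
  moreover have "\<bar>u (Suc k) $ i - u k $ i\<bar> = a (e k) i (\<mu> (e k))" for k i
    using bd[OF \<mu>(1), of "e k" i "e k"] by (auto simp: u_def sg_def abs_mult)
  moreover have "u 0 = 0"
    by (simp add: u_def vec_eq_iff)
  ultimately show ?thesis
    using \<mu>(1) by blast
qed

section \<open>Connection probabilities at criticality\<close>

lemma bern_expect_1: "finite V \<Longrightarrow> bern_expect 1 V f = f V"
  by (induction V arbitrary: f rule: finite_induct) (auto simp: bern_expect_insert)

lemma outer_bd_nonempty:
  assumes "finite S" "S \<noteq> {}"
  shows "outer_bd S \<noteq> {}"
proof -
  fix i
  define m where "m = Max ((\<lambda>y. y $ i) ` S)"
  have "m \<in> (\<lambda>y. y $ i) ` S"
    unfolding m_def using assms by (intro Max_in) auto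
  then obtain y where y: "y \<in> S" "y $ i = m" by auto
  have "y + axis i 1 \<notin> S"
  proof
    assume "y + axis i 1 \<in> S"
    then have "(y + axis i 1) $ i \<le> m"
      unfolding m_def using assms by (intro Max_ge finite_imageI imageI)
    then show False using y by (simp add: axis_def)
  qed
  then show ?thesis
    using y neighbours_axis(1) by (auto simp: outer_bd_def)
qed

lemma exit_sum_zero: "exit_sum 0 {0} (0 :: 'd::finite site) = 0"
  unfolding exit_sum_def
  by (intro sum.neutral) (auto simp: bern_expect_insert dest: conn_in1)

lemma critical_prob_bounds: "critical_prob TYPE('d::finite) \<in> {0..1}"
  and critical_prob_ge:
    "\<lbrakk>p \<in> {0..1}; finite S; 0 \<in> S; exit_sum p S (0 :: 'd site) < 1\<rbrakk> \<Longrightarrow> p \<le> critical_prob TYPE('d)"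
proof -
  let ?X = "{p \<in> {0..1}. \<P>(\<omega> in (site_percolation p :: 'd config measure). has_infinite_cluster \<omega>) = 0}"
  have bdd: "bdd_above ?X"
    by (rule bdd_aboveI[of _ 1]) auto
  show ge: "p \<le> critical_prob TYPE('d)"
    if "p \<in> {0..1}" "finite S" "0 \<in> S" "exit_sum p S (0 :: 'd site) < 1" for p S
    unfolding critical_prob_def using infinite_cluster_null[OF that] that(1) bdd
    by (intro cSup_upper) auto
  \<comment> \<open>At \<open>p = 0\<close> the exit sum of \<open>{0}\<close> vanishes; this makes
    the supremum one over a nonempty set.\<close>
  have "0 \<in> ?X"
    using infinite_cluster_null[of 0 "{0 :: 'd site}"] exit_sum_zero[where 'd = 'd] by auto
  then show "critical_prob TYPE('d) \<in> {0..1}"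
    unfolding critical_prob_def using bdd
    by (auto intro!: cSup_upper cSup_least)
qed

text \<open>By continuity in \<open>p\<close>, an exit sum below 1 at the critical value would stay
  below 1 slightly above it, where there would still be almost surely no infinite cluster.\<close>

lemma exit_sum_critical:
  fixes S :: "'d::finite site set"
  assumes S: "finite S" "0 \<in> S" "\<And>y. y \<in> S \<Longrightarrow> conn S 0 y"
  shows "1 \<le> exit_sum (critical_prob TYPE('d)) S 0"
proof (rule ccontr)
  let ?pc = "critical_prob TYPE('d)"
  assume "\<not> ?thesis"
  then have less: "exit_sum ?pc S 0 < 1" by simp
  show False
  proof (cases "?pc = 1")
    case True
    \<comment> \<open>No larger parameter is available here. But at \<open>p = 1\<close> all of the
      connected set \<open>S\<close> is open, so a single boundary site already contributes
      1.\<close>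
    obtain x where x: "x \<in> outer_bd S"
      using outer_bd_nonempty S by blast
    then obtain y where "y \<in> S" "neighbours y x"
      by (auto simp: outer_bd_def)
    then have "1 = bern_expect 1 S (\<lambda>T. of_bool (\<exists>y. neighbours y x \<and> conn T 0 y))"
      using S by (auto simp: bern_expect_1)
    also have "\<dots> \<le> exit_sum 1 S 0"
      unfolding exit_sum_def using x finite_outer_bd[OF S(1)]
      by (intro member_le_sum) (auto intro: bern_expect_nonneg)
    finally show False
      using less True by simp
  next
    case False
    then have "?pc < 1"
      using critical_prob_bounds[where 'd = 'd] by auto
    have "continuous_on UNIV (\<lambda>p. exit_sum p S 0)"
      unfolding exit_sum_def by (intro continuous_on_sum continuous_bern_expect)
    then have "((\<lambda>p. exit_sum p S 0) \<longlongrightarrow> exit_sum ?pc S 0) (at_right ?pc)"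
      by (auto simp: continuous_on_def intro: tendsto_within_subset)
    then have "eventually (\<lambda>p. exit_sum p S 0 < 1) (at_right ?pc)"
      using less by (rule order_tendstoD)
    moreover have "eventually (\<lambda>p. p \<in> {?pc<..<1}) (at_right ?pc)"
      using \<open>?pc < 1\<close> by (rule eventually_at_right_real)
    ultimately have "eventually (\<lambda>p. exit_sum p S 0 < 1 \<and> p \<in> {?pc<..<1}) (at_right ?pc)"
      by eventually_elim simp
    then obtain p where "exit_sum p S 0 < 1" "p \<in> {?pc<..<1}"
      using eventually_happens'[OF trivial_limit_at_right_real] by blast
    then show False
      using critical_prob_ge[of p S] critical_prob_bounds[where 'd = 'd] S by auto
  qed
qed

lemma critical_prob_pos: "0 < critical_prob TYPE('d::finite)"
proof (rule ccontr)
  assume "\<not> ?thesis"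
  then have "critical_prob TYPE('d) = 0"
    using critical_prob_bounds[where 'd = 'd] by auto
  then have "1 \<le> exit_sum 0 {0 :: 'd site} 0"
    using exit_sum_critical[of "{0 :: 'd site}"] by (auto intro: conn_refl)
  then show False
    using exit_sum_zero[where 'd = 'd] by simp
qed

section \<open>Connection probabilities: monotonicity, concatenation and good sites\<close>

definition conn_prob :: "real \<Rightarrow> 'd::finite site set \<Rightarrow> 'd site \<Rightarrow> 'd site \<Rightarrow> real" where
  "conn_prob p V x y = bern_expect p V (\<lambda>T. of_bool (conn T x y))"

lemma conn_prob_nonneg: "p \<in> {0..1} \<Longrightarrow> 0 \<le> conn_prob p V x y"
  by (auto simp: conn_prob_def intro: bern_expect_nonneg)

lemma bern_expect_all_open:
  assumes "finite V" "J \<subseteq> V"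
  shows "bern_expect p V (\<lambda>T. of_bool (J \<subseteq> T)) = p ^ card J"
proof -
  have fJ: "finite J"
    using assms finite_subset by blast
  have "bern_expect p V (\<lambda>T. of_bool (J \<subseteq> T)) = bern_expect p V (\<lambda>T. of_bool (J \<subseteq> T \<inter> J))"
    by simp
  also have "\<dots> = bern_expect p J (\<lambda>T. of_bool (J \<subseteq> T))"
    using assms by (rule bern_expect_marginal)
  also have "\<dots> = (\<Sum>T\<in>Pow J. if T = J then p ^ card J else 0)"
    unfolding bern_expect_def by (intro sum.cong) auto
  also have "\<dots> = p ^ card J"
    using fJ by simp
  finally show ?thesis .
qed

lemma conn_prob_mono:
  assumes "p \<in> {0..1}" "finite V" "U \<subseteq> V"
  shows "conn_prob p U x y \<le> conn_prob p V x y"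
proof -
  have "conn_prob p U x y = bern_expect p V (\<lambda>T. of_bool (conn (T \<inter> U) x y))"
    unfolding conn_prob_def using assms by (intro bern_expect_marginal[symmetric])
  also have "\<dots> \<le> conn_prob p V x y"
    unfolding conn_prob_def
    by (intro bern_expect_mono assms) (auto dest: conn_mono[of _ _ _ T for T])
  finally show ?thesis .
qed

lemma conn_prob_trans:
  assumes "p \<in> {0..1}" "finite V"
  shows "conn_prob p V x y * conn_prob p V y z \<le> conn_prob p V x z"
proof -
  have m: "mono (\<lambda>T. of_bool (conn T a b) :: real)" for a b :: "'d::finite site"
    by (auto simp: mono_def dest: conn_mono)
  have "conn_prob p V x y * conn_prob p V y z \<le>
      bern_expect p V (\<lambda>T. of_bool (conn T x y) * of_bool (conn T y z))"
    unfolding conn_prob_def by (intro bern_expect_Harris assms m)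
  also have "\<dots> \<le> conn_prob p V x z"
    unfolding conn_prob_def
    by (intro bern_expect_mono assms) (auto dest: conn_trans)
  finally show ?thesis .
qed

lemma conn_prob_image:
  assumes "p \<in> {0..1}" "inj_on \<sigma> V" "\<And>a b. neighbours a b \<Longrightarrow> neighbours (\<sigma> a) (\<sigma> b)"
  shows "conn_prob p V x y \<le> conn_prob p (\<sigma> ` V) (\<sigma> x) (\<sigma> y)"
  unfolding conn_prob_def bern_expect_image[OF assms(2)]
  by (intro bern_expect_mono assms) (auto dest: conn_image[OF _ assms(3)])

text \<open>
  A component of \<open>G\<close> avoiding the boundary of the box would have exit sum less than 1, since its
  outer boundary would lie in the box but not in \<open>G\<close>.
\<close>

lemma good_component:
  fixes n :: int
  assumes "1 \<le> n"
  defines "p \<equiv> critical_prob TYPE('d::finite)"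
  defines "G \<equiv> {z :: 'd site \<in> lattice_box n. p / of_int (2 * n + 1) ^ CARD('d) \<le>
      conn_prob p (lattice_box n) 0 z}"
  shows "\<exists>z. conn G 0 z \<and> max_norm z = n"
proof (rule ccontr)
  assume neg: "\<not> ?thesis"
  let ?B = "lattice_box n :: 'd site set" and ?K = "real_of_int (2 * n + 1) ^ CARD('d)"
  have p: "p \<in> {0..1}" "0 < p"
    unfolding p_def by (rule critical_prob_bounds critical_prob_pos)+
  have K: "1 \<le> ?K"
    using assms(1) by (intro one_le_power) linarith
  define S where "S = {z. conn G 0 z}"
  have SG: "S \<subseteq> G" and GB: "G \<subseteq> ?B"
    using conn_in2 by (auto simp: S_def G_def)
  \<comment> \<open>By \<open>neg\<close>, \<open>S\<close> avoids the sites of norm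
    \<open>n\<close>; this leaves room in the box for its outer boundary.\<close>
  have SB: "S \<subseteq> lattice_box (n - 1)"
  proof
    fix z assume "z \<in> S"
    then have "max_norm z \<noteq> n" "max_norm z \<le> n"
      using neg SG GB by (auto simp: S_def in_lattice_box_iff)
    then show "z \<in> lattice_box (n - 1)"
      by (simp add: in_lattice_box_iff)
  qed
  have finS: "finite S"
    using SB finite_subset finite_lattice_box by blast
  have zero: "0 \<in> ?B"
    using assms(1) by (simp add: in_lattice_box_iff)
  have "conn_prob p ?B 0 0 \<ge> bern_expect p ?B (\<lambda>T. of_bool ({0} \<subseteq> T))"
    unfolding conn_prob_def by (intro bern_expect_mono p) (auto intro: conn_refl)
  then have "p \<le> conn_prob p ?B 0 0"
    using zero by (subst (asm) bern_expect_all_open) auto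
  moreover have "p / ?K \<le> p"
    using K p by (simp add: divide_le_eq mult_le_cancel_left1)
  ultimately have "0 \<in> G"
    using zero by (simp add: G_def)
  then have S0: "0 \<in> S"
    by (simp add: S_def conn_refl)
  have bdB: "outer_bd S \<subseteq> ?B"
    using outer_bd_subset_box[OF SB] by simp
  have exit_less: "bern_expect p S (\<lambda>T. of_bool (\<exists>y. neighbours y x \<and> conn T 0 y)) < 1 / ?K"
    if x: "x \<in> outer_bd S" for x
  proof -
    let ?f = "\<lambda>T. of_bool (\<exists>y. neighbours y x \<and> conn T 0 y) :: real"
    have xS: "x \<notin> S" and "x \<in> ?B"
      using x bdB by (auto simp: outer_bd_def)
    have "x \<notin> G"
    proof
      assume "x \<in> G"
      moreover obtain y where "y \<in> S" "neighbours y x"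
        using x by (auto simp: outer_bd_def)
      ultimately show False
        using xS conn_step by (auto simp: S_def)
    qed
    \<comment> \<open>Openness of \<open>x\<close> is independent of the exit event on
      \<open>S\<close>, and together they connect 0 to \<open>x\<close> in the box. The factor
      \<open>p\<close> paid for this cancels against the \<open>p\<close> in the threshold of
      \<open>G\<close>.\<close>
    have "p * bern_expect p S ?f = bern_expect p (S \<union> {x}) (\<lambda>T. ?f (T \<inter> S) * of_bool ({x} \<subseteq> T \<inter> {x}))"
      using bern_expect_indep[of S "{x}" p ?f "\<lambda>T. of_bool ({x} \<subseteq> T)"] xS finS
        bern_expect_all_open[of "{x}" "{x}" p] by simp
    also have "\<dots> \<le> conn_prob p (S \<union> {x}) 0 x"
      unfolding conn_prob_def
    proof (intro bern_expect_mono p)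
      fix T
      have "conn T 0 x" if "conn (T \<inter> S) 0 y" "neighbours y x" "x \<in> T" for y
        using that conn_mono[of "T \<inter> S" 0 y T] by (auto intro: conn_step)
      then show "?f (T \<inter> S) * of_bool ({x} \<subseteq> T \<inter> {x}) \<le> (of_bool (conn T 0 x) :: real)"
        by auto
    qed
    also have "\<dots> \<le> conn_prob p ?B 0 x"
      using SG GB \<open>x \<in> ?B\<close> by (intro conn_prob_mono p) auto
    also have "\<dots> < p / ?K"
      using \<open>x \<notin> G\<close> \<open>x \<in> ?B\<close> by (simp add: G_def)
    finally have "p * bern_expect p S ?f < p * (1 / ?K)"
      by simp
    then show ?thesis
      using p(2) by (simp only: mult_less_cancel_left_pos)
  qed
  have conn_S: "conn S 0 y" if "y \<in> S" for y
    using that conn_cluster[of G 0 y] by (simp add: S_def)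
  have "1 \<le> exit_sum p S 0"
    unfolding p_def by (intro exit_sum_critical finS S0 conn_S)
  \<comment> \<open>\<open>?K\<close> bounds the number of sites of the box, which contains
    \<open>outer_bd S\<close>, so the sum cannot exceed 1.\<close>
  also have "\<dots> < (\<Sum>x\<in>outer_bd S. 1 / ?K)"
    unfolding exit_sum_def using finS S0 exit_less
    by (intro sum_strict_mono finite_outer_bd outer_bd_nonempty) auto
  also have "\<dots> = real (card (outer_bd S)) / ?K"
    by simp
  also have "\<dots> \<le> 1"
  proof -
    have "card (outer_bd S) \<le> card ?B"
      by (intro card_mono bdB) simp
    also have "\<dots> \<le> nat (2 * n + 1) ^ CARD('d)"
      by (rule card_lattice_box_le)
    finally have "real (card (outer_bd S)) \<le> real (nat (2 * n + 1) ^ CARD('d))"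
      by (rule of_nat_mono)
    also have "\<dots> = ?K"
      using assms(1) by simp
    finally show ?thesis
      using K by (simp add: divide_le_eq)
  qed
  finally show False by simp
qed

lemma conn_sequence:
  assumes "conn G x y"
  shows "\<exists>N (\<gamma> :: nat \<Rightarrow> 'd::finite site). \<gamma> 0 = x \<and> \<gamma> N = y \<and> (\<forall>m\<le>N. \<gamma> m \<in> G) \<and>
    (\<forall>m<N. neighbours (\<gamma> m) (\<gamma> (Suc m)))"
  using assms
proof (induction rule: conn_induct)
  case refl
  then show ?case by (intro exI[of _ 0] exI[of _ "\<lambda>_. x"]) simp
next
  case (step y z)
  then obtain N \<gamma> where g: "\<gamma> 0 = x" "\<gamma> N = y" "\<forall>m\<le>N. \<gamma> m \<in> G"
    "\<forall>m<N. neighbours (\<gamma> m) (\<gamma> (Suc m))"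
    by blast
  show ?case
    using g step.hyps by (intro exI[of _ "Suc N"] exI[of _ "\<lambda>m. if m \<le> N then \<gamma> m else z"])
      (auto simp: less_Suc_eq le_Suc_eq)
qed

text \<open>A permutation of the coordinates with signs, followed by translation by
  \<open>u\<close>, takes 0 to \<open>u\<close> and \<open>z\<close> to \<open>v\<close>. It
  preserves adjacency and maps the box into its translate.\<close>

lemma conn_prob_symmetry:
  fixes z u v :: "'d::finite site" and \<pi> :: "'d \<Rightarrow> 'd"
  assumes p: "p \<in> {0..1}" and \<pi>: "bij \<pi>" and n: "\<And>i. \<bar>v $ i - u $ i\<bar> = \<bar>z $ \<pi> i\<bar>"
  shows "conn_prob p (lattice_box m) 0 z \<le> conn_prob p ((+) u ` lattice_box m) u v"
proof -
  define s :: "'d \<Rightarrow> int" where "s i = (if v $ i - u $ i = z $ \<pi> i then 1 else -1)" for i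
  define \<sigma> :: "'d site \<Rightarrow> 'd site" where "\<sigma> a = (\<chi> i. u $ i + s i * a $ \<pi> i)" for a
  have s: "\<bar>s i\<bar> = 1" for i
    by (simp add: s_def)
  have "inj \<sigma>"
  proof (rule injI)
    fix a b assume "\<sigma> a = \<sigma> b"
    then have "a $ \<pi> i = b $ \<pi> i" for i
      by (auto simp: \<sigma>_def vec_eq_iff s_def split: if_splits dest: spec[of _ i])
    then have "a $ i = b $ i" for i
      using \<pi> by (metis bij_pointE)
    then show "a = b"
      by (simp add: vec_eq_iff)
  qed
  have nb: "neighbours (\<sigma> a) (\<sigma> b)" if "neighbours a b" for a b
  proof -
    have "\<bar>\<sigma> a $ i - \<sigma> b $ i\<bar> = \<bar>a $ \<pi> i - b $ \<pi> i\<bar>" for i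
      by (auto simp: \<sigma>_def s_def)
    then have "l1_dist (\<sigma> a) (\<sigma> b) = (\<Sum>i\<in>UNIV. \<bar>a $ \<pi> i - b $ \<pi> i\<bar>)"
      by (simp add: l1_dist_def)
    also have "\<dots> = l1_dist a b"
      unfolding l1_dist_def by (rule sum.reindex_bij_betw) (fact \<pi>)
    finally show ?thesis
      using that by (simp add: neighbours_def)
  qed
  have "\<sigma> 0 = u"
    by (simp add: \<sigma>_def vec_eq_iff)
  moreover have "\<sigma> z = v"
    using n by (auto simp: \<sigma>_def s_def vec_eq_iff abs_eq_iff) (smt (verit))
  moreover have "\<sigma> ` lattice_box m \<subseteq> (+) u ` lattice_box m"
  proof
    fix b assume "b \<in> \<sigma> ` lattice_box m"
    then obtain a where a: "a \<in> lattice_box m" "b = \<sigma> a" by blast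
    have "\<bar>(b - u) $ i\<bar> \<le> m" for i
      using a abs_le_max_norm[of a "\<pi> i"] by (auto simp: \<sigma>_def abs_mult s in_lattice_box_iff)
    then have "b - u \<in> lattice_box m"
      by (simp add: in_lattice_box_iff max_norm_le_iff)
    then show "b \<in> (+) u ` lattice_box m"
      by (metis add.commute diff_add_cancel imageI)
  qed
  ultimately show ?thesis
    using conn_prob_image[OF p inj_on_subset[OF \<open>inj \<sigma>\<close> subset_UNIV] nb, of "lattice_box m" 0 z]
      conn_prob_mono[OF p, of "(+) u ` lattice_box m" "\<sigma> ` lattice_box m" u v] by simp
qed

lemma conn_path:
  assumes "conn T x y"
  shows "\<exists>vs. lattice_path vs \<and> hd vs = x \<and> last vs = y \<and> set vs \<subseteq> T"
  using assms
proof (induction rule: conn_induct)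
  case refl
  then show ?case
    by (intro exI[of _ "[x]"]) (simp add: lattice_path_def)
next
  case (step y z)
  then obtain vs where vs: "lattice_path vs" "hd vs = x" "last vs = y" "set vs \<subseteq> T"
    by blast
  then show ?case
    using step.hyps
    by (intro exI[of _ "vs @ [z]"])
      (auto simp: lattice_path_def successively_append_iff neighbours_def)
qed

lemma conn_prob_le_open_connection:
  fixes A :: "'d::finite site set"
  assumes "p \<in> {0..1}" "finite A"
  shows "conn_prob p A x y \<le> \<P>(\<omega> in site_percolation p. open_connection_in \<omega> A x y)"
proof -
  define Q where "Q T \<longleftrightarrow> (\<exists>vs. lattice_path vs \<and> hd vs = x \<and> last vs = y \<and> set vs \<subseteq> T)" for T
  have "{\<omega>. open_connection_in \<omega> A x y} = {\<omega>. Q {v \<in> A. \<omega> v}}"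
    by (auto simp: open_connection_in_def Q_def subset_iff)
  then have "\<P>(\<omega> in site_percolation p. open_connection_in \<omega> A x y) =
      bern_expect p A (\<lambda>T. of_bool (Q T))"
    using site_percolation_finite_event(2)[OF assms(2,1), of Q] by simp
  also have "conn_prob p A x y \<le> \<dots>"
    unfolding conn_prob_def
    by (intro bern_expect_mono assms) (auto simp: Q_def dest: conn_path)
  finally show ?thesis .
qed

text \<open>Moving a nonzero coordinate one unit towards 0 stays in the box and lowers the l1
  norm.\<close>

lemma conn_lattice_box:
  fixes w :: "'d::finite site"
  assumes "w \<in> lattice_box r"
  shows "conn (lattice_box r) 0 w"
  using assms
proof (induction "nat (l1_dist w 0)" arbitrary: w rule: less_induct)
  case less
  show ?case
  proof (cases "w = 0")
    case True
    then show ?thesis using less.prems by (simp add: conn_refl)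
  next
    case False
    then obtain i where i: "w $ i \<noteq> 0"
      by (auto simp: vec_eq_iff)
    define u where "u = w - axis i (sgn (w $ i))"
    have u: "\<bar>u $ j\<bar> = (if j = i then \<bar>w $ i\<bar> - 1 else \<bar>w $ j\<bar>)" for j
      using i by (auto simp: u_def axis_def sgn_if)
    have "\<bar>u $ j\<bar> \<le> \<bar>w $ j\<bar>" for j
      by (simp add: u)
    then have "u \<in> lattice_box r"
      using less.prems unfolding in_lattice_box_iff max_norm_le_iff by (meson order_trans)
    moreover have "l1_dist u 0 < l1_dist w 0"
      unfolding l1_dist_def by (intro sum_strict_mono_ex1) (auto simp: u)
    moreover have "0 \<le> l1_dist u 0"
      by (simp add: l1_dist_def sum_nonneg)
    ultimately have "conn (lattice_box r) 0 u"
      using less.hyps by simp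
    moreover have "neighbours u w"
    proof -
      have "neighbours w u"
        using i neighbours_axis[of w i] by (cases "0 < w $ i")
          (auto simp: u_def sgn_if axis_def neighbours_def l1_dist_def if_distrib cong: if_cong)
      then show ?thesis
        by (simp add: neighbours_commute)
    qed
    ultimately show ?thesis
      using less.prems by (rule conn_step)
  qed
qed

text \<open>Crude bound from opening the whole box of radius \<open>r\<close> around
  \<open>u\<close>. It serves for the rounding error at the end of the walk and for small
  \<open>x\<close>.\<close>

lemma conn_prob_box_ge:
  fixes u v :: "'d::finite site"
  assumes p: "p \<in> {0..1}" and v: "v - u \<in> lattice_box r" and V: "finite V" "(+) u ` lattice_box r \<subseteq> V"
  shows "p ^ (nat (2 * r + 1) ^ CARD('d)) \<le> conn_prob p V u v"
proof -
  let ?J = "(+) u ` (lattice_box r :: 'd site set)"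
  have "conn ?J (u + 0) (u + (v - u))"
    using conn_lattice_box[OF v] by (rule conn_image) (simp only: neighbours_translate)
  then have J: "conn T u v" if "?J \<subseteq> T" for T
    using conn_mono that by simp
  have "card ?J \<le> card (lattice_box r :: 'd site set)"
    by (rule card_image_le) simp
  then have "card ?J \<le> nat (2 * r + 1) ^ CARD('d)"
    using card_lattice_box_le order_trans by blast
  then have "p ^ (nat (2 * r + 1) ^ CARD('d)) \<le> p ^ card ?J"
    using p by (intro power_decreasing) auto
  also have "\<dots> = bern_expect p V (\<lambda>T. of_bool (?J \<subseteq> T))"
    using V by (simp add: bern_expect_all_open)
  also have "\<dots> \<le> conn_prob p V u v"
    unfolding conn_prob_def using J by (intro bern_expect_mono p) auto
  finally show ?thesis .
qed

text \<open>The three factors pay for opening 0, for the \<open>d\<close> steps to good sites, and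
  for the final gap of norm at most \<open>d\<close>.\<close>

lemma conn_prob_box_lower:
  fixes x :: "'d::finite site"
  defines "d \<equiv> CARD('d)" and "p \<equiv> critical_prob TYPE('d)"
  assumes n: "max_norm x = n" "int d \<le> n"
  shows "p * (p / of_int (2 * n + 1) ^ d) ^ d * p ^ ((2 * d + 1) ^ d) \<le>
    conn_prob p (lattice_box (4 * n)) 0 x"
proof -
  let ?B = "lattice_box n :: 'd site set" and ?C = "lattice_box (4 * n) :: 'd site set"
  let ?\<delta> = "p / of_int (2 * n + 1) ^ d"
  have p: "p \<in> {0..1}"
    unfolding p_def by (rule critical_prob_bounds)
  have d: "1 \<le> d"
    by (simp add: d_def Suc_leI)
  then have n1: "1 \<le> n"
    using n by linarith
  obtain z where z: "conn {z \<in> ?B. ?\<delta> \<le> conn_prob p ?B 0 z} 0 z" "max_norm z = n"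
    using good_component[where 'd = 'd, OF n1] unfolding p_def d_def by blast
  obtain N \<gamma> where \<gamma>: "\<gamma> 0 = 0" "\<gamma> N = z" "\<And>m. m \<le> N \<Longrightarrow> \<gamma> m \<in> ?B"
    "\<And>m. m \<le> N \<Longrightarrow> ?\<delta> \<le> conn_prob p ?B 0 (\<gamma> m)"
    "\<And>m. m < N \<Longrightarrow> neighbours (\<gamma> m) (\<gamma> (Suc m))"
    using conn_sequence[OF z(1)] by blast
  have N: "0 < N"
    using \<gamma>(1,2) z(2) n1 by (cases N) auto
  obtain i0 where i0: "\<bar>z $ i0\<bar> = n"
    using max_norm_attained[of z] z(2) by auto
  \<comment> \<open>\<open>\<pi> j\<close> exchanges \<open>j\<close> with \<open>i0\<close>, the
    coordinate in which \<open>z\<close> attains its norm; so coordinate \<open>j\<close> of the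
    path for step \<open>j\<close> runs from 0 to \<open>n\<close> in absolute value.\<close>
  define \<pi> where "\<pi> j = Transposition.transpose j i0" for j
  define a where "a j i m = \<bar>\<gamma> m $ \<pi> j i\<bar>" for j i m
  obtain e :: "nat \<Rightarrow> 'd" where e: "bij_betw e {..<CARD('d)} UNIV"
    using ex_bij_betw_nat_finite[of "UNIV :: 'd set"] by (auto simp: atLeast0LessThan)
  have "\<exists>(\<mu> :: 'd \<Rightarrow> nat) y. (\<forall>j. \<mu> j \<le> N) \<and> y 0 = (0 :: 'd site) \<and>
    (\<forall>i. \<bar>y CARD('d) $ i - x $ i\<bar> \<le> int CARD('d)) \<and>
    (\<forall>k\<le>CARD('d). \<forall>i. \<bar>y k $ i\<bar> \<le> n + int CARD('d)) \<and>
    (\<forall>k<CARD('d). \<forall>i. \<bar>y (Suc k) $ i - y k $ i\<bar> = a (e k) i (\<mu> (e k)))"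
  proof (rule lattice_walk_exists[OF N e])
    show "a j i m \<in> {0..n}" if "m \<le> N" for j i m
      using \<gamma>(3)[OF that] by (auto simp: a_def in_lattice_box_iff max_norm_le_iff)
    show "\<bar>a j i (Suc m) - a j i m\<bar> \<le> 1" if "m < N" for j i m
      using neighbours_diff_le[OF \<gamma>(5)[OF that], of "\<pi> j i"] unfolding a_def by linarith
    show "a j j 0 = 0" "a j j N = n" for j
      using \<gamma>(1,2) i0 by (auto simp: a_def \<pi>_def)
    show "\<bar>x $ i\<bar> \<le> n" for i
      using n(1) abs_le_max_norm by blast
  qed
  then obtain \<mu> :: "'d \<Rightarrow> nat" and y where \<mu>: "\<And>j. \<mu> j \<le> N" and y: "y 0 = (0 :: 'd site)"
    "\<And>i. \<bar>y d $ i - x $ i\<bar> \<le> int d"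
    "\<And>k i. k \<le> d \<Longrightarrow> \<bar>y k $ i\<bar> \<le> n + int d"
    "\<And>k i. k < d \<Longrightarrow> \<bar>y (Suc k) $ i - y k $ i\<bar> = a (e k) i (\<mu> (e k))"
    unfolding d_def by blast
  \<comment> \<open>Intermediate points have norm at most \<open>n + d \<le> 2 * n\<close>, so boxes
    of radius up to \<open>n\<close> around them lie within \<open>3 * n\<close>.\<close>
  have sub: "(+) (y k) ` lattice_box m \<subseteq> ?C" if "k \<le> d" "m \<le> n" for k m
  proof -
    have "max_norm (y k) \<le> n + int d"
      using y(3)[OF that(1)] by (simp add: max_norm_le_iff)
    then show ?thesis
      using max_norm_triangle[of "y k"] n(2) n1 that(2)
      by (fastforce simp: in_lattice_box_iff intro: order_trans)
  qed
  have \<delta>0: "0 \<le> ?\<delta>"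
    using p n1 by (intro divide_nonneg_nonneg zero_le_power) auto
  have walk: "p * ?\<delta> ^ k \<le> conn_prob p ?C 0 (y k)" if "k \<le> d" for k
    using that
  proof (induction k)
    case 0
    have "lattice_box 0 \<subseteq> ?C"
      using n1 by (auto simp: in_lattice_box_iff)
    then have "p \<le> conn_prob p ?C 0 0"
      using conn_prob_box_ge[OF p, of "0 :: 'd site" 0 0 ?C] by (simp add: in_lattice_box_iff)
    then show ?case
      by (simp add: y(1))
  next
    case (Suc k)
    have "?\<delta> \<le> conn_prob p ?B 0 (\<gamma> (\<mu> (e k)))"
      by (intro \<gamma>(4) \<mu>)
    also have "\<dots> \<le> conn_prob p ((+) (y k) ` ?B) (y k) (y (Suc k))"
      using Suc.prems y(4)[of k]
      by (intro conn_prob_symmetry[where \<pi> = "\<pi> (e k)"] p) (auto simp: a_def \<pi>_def)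
    also have "\<dots> \<le> conn_prob p ?C (y k) (y (Suc k))"
      using Suc.prems by (intro conn_prob_mono p sub) auto
    finally have "p * ?\<delta> ^ k * ?\<delta> \<le> conn_prob p ?C 0 (y k) * conn_prob p ?C (y k) (y (Suc k))"
      using Suc \<delta>0 by (intro mult_mono conn_prob_nonneg p) auto
    also have "\<dots> \<le> conn_prob p ?C 0 (y (Suc k))"
      by (intro conn_prob_trans p) simp
    finally show ?case by (simp add: mult_ac)
  qed
  have "max_norm (x - y d) \<le> int d"
    using y(2) by (simp add: max_norm_le_iff abs_minus_commute)
  then have "p ^ (nat (2 * int d + 1) ^ CARD('d)) \<le> conn_prob p ?C (y d) x"
    using n(2) by (intro conn_prob_box_ge p sub) (auto simp: in_lattice_box_iff)
  then have "p ^ ((2 * d + 1) ^ d) \<le> conn_prob p ?C (y d) x"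
    by (simp add: d_def nat_add_distrib nat_mult_distrib)
  then have "p * ?\<delta> ^ d * p ^ ((2 * d + 1) ^ d) \<le> conn_prob p ?C 0 (y d) * conn_prob p ?C (y d) x"
    using walk[of d] p by (intro mult_mono conn_prob_nonneg) auto
  also have "\<dots> \<le> conn_prob p ?C 0 x"
    by (intro conn_prob_trans p) simp
  finally show ?thesis .
qed

theorem theorem1p1:
  assumes "CARD('d::finite) \<ge> 2"
  shows "\<exists>c::real. c > 0 \<and>
    (\<forall>x :: 'd site. x \<noteq> 0 \<longrightarrow>
      \<P>(\<omega> in site_percolation (critical_prob TYPE('d)).
          open_connection_in \<omega> (lattice_box (4 * max_norm x)) 0 x)
        \<ge> c / real_of_int (max_norm x) ^ (CARD('d)\<^sup>2))"
proof -
  define p where "p = critical_prob TYPE('d)"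
  define d where "d = CARD('d)"
  have p: "p \<in> {0..1}" "0 < p"
    unfolding p_def by (rule critical_prob_bounds critical_prob_pos)+
  \<comment> \<open>\<open>c1\<close> treats norms below \<open>d\<close>, where opening the whole
    box involves at most \<open>(8 * d + 1) ^ d\<close> sites. \<open>c2\<close> comes from the walk
    with \<open>2 * n + 1 \<le> 3 * n\<close>; its \<open>d\<close> steps, each of cost of order
    \<open>n ^ d\<close>, give the exponent \<open>d\<^sup>2\<close>.\<close>
  define c1 c2 where "c1 = p ^ ((8 * d + 1) ^ d)"
    and "c2 = p * (p / 3 ^ d) ^ d * p ^ ((2 * d + 1) ^ d)"
  have c_pos: "0 < c1" "0 < c2"
    using p(2) by (simp_all add: c1_def c2_def)
  have "min c1 c2 / real_of_int (max_norm x) ^ d\<^sup>2 \<le>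
      \<P>(\<omega> in site_percolation p. open_connection_in \<omega> (lattice_box (4 * max_norm x)) 0 x)"
    if x: "x \<noteq> 0" for x :: "'d site"
  proof -
    define n where "n = max_norm x"
    obtain i where "x $ i \<noteq> 0"
      using x by (auto simp: vec_eq_iff)
    then have n: "1 \<le> n"
      using abs_le_max_norm[of x i] by (simp add: n_def)
    then have nd: "1 \<le> real_of_int n ^ d\<^sup>2"
      by (intro one_le_power) simp
    have "min c1 c2 / real_of_int n ^ d\<^sup>2 \<le> conn_prob p (lattice_box (4 * n)) 0 x"
    proof (cases "int d \<le> n")
      case True
      have "min c1 c2 / real_of_int n ^ d\<^sup>2 \<le> c2 / real_of_int n ^ d\<^sup>2"
        using nd by (intro divide_right_mono) auto
      also have "\<dots> = p * (p / (3 * real_of_int n) ^ d) ^ d * p ^ ((2 * d + 1) ^ d)"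
        by (simp add: c2_def power_mult_distrib power_divide power2_eq_square power_mult)
      also have "\<dots> \<le> p * (p / of_int (2 * n + 1) ^ d) ^ d * p ^ ((2 * d + 1) ^ d)"
        using p n by (intro mult_right_mono mult_left_mono power_mono divide_left_mono) auto
      also have "\<dots> \<le> conn_prob p (lattice_box (4 * n)) 0 x"
        unfolding p_def d_def
        using conn_prob_box_lower[of x n] True by (simp add: n_def d_def)
      finally show ?thesis .
    next
      case False
      have "min c1 c2 / real_of_int n ^ d\<^sup>2 \<le> c1 / 1"
        using nd c_pos by (intro frac_le) auto
      also have "\<dots> \<le> p ^ (nat (2 * (4 * n) + 1) ^ d)"
        unfolding c1_def div_by_1 using p False n
        by (intro power_decreasing power_mono) auto
      also have "\<dots> \<le> conn_prob p (lattice_box (4 * n)) 0 x"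
        unfolding d_def using n by (intro conn_prob_box_ge p) (auto simp: in_lattice_box_iff n_def)
      finally show ?thesis .
    qed
    also have "\<dots> \<le> \<P>(\<omega> in site_percolation p. open_connection_in \<omega> (lattice_box (4 * n)) 0 x)"
      by (intro conn_prob_le_open_connection p) simp
    finally show ?thesis
      by (simp add: n_def)
  qed
  then show ?thesis
    using c_pos unfolding p_def d_def by (intro exI[of _ "min c1 c2"]) auto
qed

end
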